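(* Let $\mathcal{F}$ be a smooth transversely oriented codimension one foliation on a smooth manifold $M$, and let $\Phi_t$ be a smooth $1$-parameter family of diffeomorphisms of $M$. If $\mathcal{F}_t$ is the family of foliations generated by pulling back $\mathcal{F}$ via $\Phi_t$, then $TGV(\mathcal{F}_t)=0$ in $H^4(M,\mathbb{R})$.
   Context: All manifolds, foliations, forms and families are of class $C^\infty$. For a smooth $1$-parameter family $\mathcal{F}_t$ of transversely oriented codimension one foliations on $M$, choose a smooth family $\alpha=\alpha(t)$ of $1$-forms with $\alpha(t)$ defining $\mathcal{F}_t$ (nowhere zero, $\ker\alpha(t)=T\mathcal{F}_t$, positive on positively oriented transversals) and a smooth family $\beta=\beta(t)$ of $1$-forms with $d\alpha=\alpha\wedge\beta$. A dot denotes the derivative with respect to $t$. For every $t$ the form $(\dot\beta\wedge\beta\wedge d\beta)(t)$ is closed and its class $TGV(\mathcal{F}_t)=[(\dot\beta\wedge\beta\wedge d\beta)(t)]\in H^4(M,\mathbb{R})$ is independent of the choices of $\alpha$ and $\beta$. *)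

theory Defs
  imports "HOL-Analysis.Analysis"
begin

text \<open>
  Smooth maps. For every set S used below, S is open. The recursion says that a map is
  of class n + 1 iff it is differentiable and all its directional derivatives are of class n.
\<close>

fun class_C_on :: "nat \<Rightarrow> 'a::real_normed_vector set \<Rightarrow> ('a \<Rightarrow> 'b::real_normed_vector) \<Rightarrow> bool" where
  "class_C_on 0 S f \<longleftrightarrow> continuous_on S f"
| "class_C_on (Suc n) S f \<longleftrightarrow>
     (\<forall>x\<in>S. f differentiable (at x)) \<and>
     (\<forall>v. class_C_on n S (\<lambda>x. frechet_derivative f (at x) v))"

definition smooth_on :: "'a::real_normed_vector set \<Rightarrow> ('a \<Rightarrow> 'b::real_normed_vector) \<Rightarrow> bool" where
  "smooth_on S f \<longleftrightarrow> (\<forall>n. class_C_on n S f)"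


text \<open>
  Smooth manifolds. The underlying space is a whole type, Hausdorff and second countable by
  its type class; the model space is a Euclidean space of arbitrary positive dimension
  (a manifold of dimension 0 carries no codimension one foliation). A chart is a domain
  together with a map whose values outside the domain are irrelevant. A smooth
  structure is a maximal smooth atlas.
\<close>

type_synonym ('m, 'e) chart = "'m set \<times> ('m \<Rightarrow> 'e)"

abbreviation chart_dom :: "('m, 'e) chart \<Rightarrow> 'm set" where
  "chart_dom c \<equiv> fst c"

abbreviation chart_map :: "('m, 'e) chart \<Rightarrow> 'm \<Rightarrow> 'e" where
  "chart_map c \<equiv> snd c"

definition chart_ran :: "('m, 'e) chart \<Rightarrow> 'e set" where
  "chart_ran c = chart_map c ` chart_dom c"

definition chart_inv :: "('m, 'e) chart \<Rightarrow> 'e \<Rightarrow> 'm" where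
  "chart_inv c = inv_into (chart_dom c) (chart_map c)"

definition is_chart :: "('m::topological_space, 'e::euclidean_space) chart \<Rightarrow> bool" where
  "is_chart c \<longleftrightarrow> open (chart_dom c) \<and> open (chart_ran c) \<and>
     homeomorphism (chart_dom c) (chart_ran c) (chart_map c) (chart_inv c)"

definition transition :: "('m, 'e) chart \<Rightarrow> ('m, 'e) chart \<Rightarrow> 'e \<Rightarrow> 'e" where
  "transition c c' = chart_map c' \<circ> chart_inv c"

definition compatible ::
  "('m, 'e::euclidean_space) chart \<Rightarrow> ('m, 'e) chart \<Rightarrow> bool" where
  "compatible c c' \<longleftrightarrow>
     smooth_on (chart_map c ` (chart_dom c \<inter> chart_dom c')) (transition c c') \<and>
     smooth_on (chart_map c' ` (chart_dom c \<inter> chart_dom c')) (transition c' c)"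

definition smooth_structure ::
  "('m::{t2_space, second_countable_topology}, 'e::euclidean_space) chart set \<Rightarrow> bool" where
  "smooth_structure A \<longleftrightarrow>
     (\<forall>c\<in>A. is_chart c) \<and>
     (\<Union>c\<in>A. chart_dom c) = UNIV \<and>
     (\<forall>c\<in>A. \<forall>c'\<in>A. compatible c c') \<and>
     (\<forall>c. is_chart c \<and> (\<forall>c'\<in>A. compatible c c') \<longrightarrow> c \<in> A)"

definition smooth_map ::
  "('m::topological_space, 'e::euclidean_space) chart set \<Rightarrow> ('m \<Rightarrow> 'm) \<Rightarrow> bool" where
  "smooth_map A f \<longleftrightarrow> continuous_on UNIV f \<and>
     (\<forall>c\<in>A. \<forall>c'\<in>A.
        smooth_on (chart_map c ` (chart_dom c \<inter> f -` chart_dom c'))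
          (chart_map c' \<circ> f \<circ> chart_inv c))"

definition diffeomorphism ::
  "('m::topological_space, 'e::euclidean_space) chart set \<Rightarrow> ('m \<Rightarrow> 'm) \<Rightarrow> bool" where
  "diffeomorphism A f \<longleftrightarrow> bij f \<and> smooth_map A f \<and> smooth_map A (inv f)"

text \<open>
  A smooth family of diffeomorphisms: each member is a diffeomorphism, and the family is
  smooth as a map from the product of the parameter interval and the manifold.
\<close>

definition smooth_diffeo_family ::
  "('m::topological_space, 'e::euclidean_space) chart set \<Rightarrow> real set \<Rightarrow> (real \<Rightarrow> 'm \<Rightarrow> 'm) \<Rightarrow> bool" where
  "smooth_diffeo_family A I \<Phi> \<longleftrightarrow>
     (\<forall>t\<in>I. diffeomorphism A (\<Phi> t)) \<and>
     continuous_on (I \<times> UNIV) (\<lambda>(t, p). \<Phi> t p) \<and>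
     (\<forall>c\<in>A. \<forall>c'\<in>A.
        smooth_on {(t, x). t \<in> I \<and> x \<in> chart_ran c \<and> \<Phi> t (chart_inv c x) \<in> chart_dom c'}
          (\<lambda>(t, x). chart_map c' (\<Phi> t (chart_inv c x))))"


text \<open>
  Differential forms. A form is the collection of its local representatives, one for each
  chart of the maximal atlas, related by pullback along the transition maps. A
  representative assigns to a point of the chart image an alternating k-linear function,
  given on lists of k vectors. Values outside of this range are set to 0, so that
  forms are equal iff they are equal as functions.
\<close>

type_synonym ('m, 'e) form = "('m, 'e) chart \<Rightarrow> 'e \<Rightarrow> 'e list \<Rightarrow> real"

definition alternating_form :: "nat \<Rightarrow> ('e::euclidean_space list \<Rightarrow> real) \<Rightarrow> bool" where
  "alternating_form k f \<longleftrightarrow>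
     (\<forall>vs. length vs \<noteq> k \<longrightarrow> f vs = 0) \<and>
     (\<forall>vs i. length vs = k \<and> i < k \<longrightarrow> linear (\<lambda>v. f (vs[i := v]))) \<and>
     (\<forall>vs i j. length vs = k \<and> i < j \<and> j < k \<and> vs ! i = vs ! j \<longrightarrow> f vs = 0)"

definition diff_form ::
  "('m, 'e::euclidean_space) chart set \<Rightarrow> nat \<Rightarrow> ('m, 'e) form \<Rightarrow> bool" where
  "diff_form A k \<omega> \<longleftrightarrow>
     (\<forall>c x. c \<notin> A \<or> x \<notin> chart_ran c \<longrightarrow> \<omega> c x = (\<lambda>_. 0)) \<and>
     (\<forall>c\<in>A. \<forall>x\<in>chart_ran c. alternating_form k (\<omega> c x)) \<and>
     (\<forall>c\<in>A. \<forall>vs. length vs = k \<longrightarrow> smooth_on (chart_ran c) (\<lambda>x. \<omega> c x vs)) \<and>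
     (\<forall>c\<in>A. \<forall>c'\<in>A. \<forall>p\<in>chart_dom c \<inter> chart_dom c'. \<forall>vs. length vs = k \<longrightarrow>
        \<omega> c (chart_map c p) vs =
        \<omega> c' (chart_map c' p)
          (map (frechet_derivative (transition c c') (at (chart_map c p))) vs))"

definition smooth_form_family ::
  "('m, 'e::euclidean_space) chart set \<Rightarrow> real set \<Rightarrow> nat \<Rightarrow> (real \<Rightarrow> ('m, 'e) form) \<Rightarrow> bool" where
  "smooth_form_family A I k \<omega> \<longleftrightarrow>
     (\<forall>t\<in>I. diff_form A k (\<omega> t)) \<and>
     (\<forall>c\<in>A. \<forall>vs. length vs = k \<longrightarrow>
        smooth_on (I \<times> chart_ran c) (\<lambda>(t, x). \<omega> t c x vs))"

definition dot :: "(real \<Rightarrow> ('m, 'e) form) \<Rightarrow> real \<Rightarrow> ('m, 'e) form" where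
  "dot \<omega> t = (\<lambda>c x vs. deriv (\<lambda>s. \<omega> s c x vs) t)"

text \<open>
  Wedge product of a k-form and an l-form, normalized so that
  (a \<and> b)(v, w) = a(v) b(w) - a(w) b(v) for 1-forms; exterior derivative of a k-form,
  normalized correspondingly.
\<close>

definition wedge :: "nat \<Rightarrow> nat \<Rightarrow> ('m, 'e) form \<Rightarrow> ('m, 'e) form \<Rightarrow> ('m, 'e) form" where
  "wedge k l \<omega> \<eta> = (\<lambda>c x vs.
     if length vs = k + l then
       (\<Sum>\<sigma> | \<sigma> permutes {..<k + l}.
          of_int (sign \<sigma>) * \<omega> c x (map (\<lambda>i. vs ! \<sigma> i) [0..<k])
                          * \<eta> c x (map (\<lambda>i. vs ! \<sigma> i) [k..<k + l]))
       / (fact k * fact l)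
     else 0)"

definition ext_d :: "nat \<Rightarrow> ('m, 'e::euclidean_space) form \<Rightarrow> ('m, 'e) form" where
  "ext_d k \<omega> = (\<lambda>c x vs.
     if x \<in> chart_ran c \<and> length vs = Suc k then
       (\<Sum>i\<le>k. (-1) ^ i *
          frechet_derivative (\<lambda>y. \<omega> c y (take i vs @ drop (Suc i) vs)) (at x) (vs ! i))
     else 0)"


text \<open>
  De Rham cohomology; classes are cosets of the exact forms inside the closed forms. The
  class of a form that is not closed is the empty set, which is not an element of the quotient.
\<close>

definition zero_form :: "('m, 'e) form" where
  "zero_form = (\<lambda>c x vs. 0)"

definition closed_form ::
  "('m, 'e::euclidean_space) chart set \<Rightarrow> nat \<Rightarrow> ('m, 'e) form \<Rightarrow> bool" where
  "closed_form A k \<omega> \<longleftrightarrow> diff_form A k \<omega> \<and> ext_d k \<omega> = zero_form"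

definition exact_form ::
  "('m, 'e::euclidean_space) chart set \<Rightarrow> nat \<Rightarrow> ('m, 'e) form \<Rightarrow> bool" where
  "exact_form A k \<omega> \<longleftrightarrow>
     (case k of 0 \<Rightarrow> \<omega> = zero_form | Suc j \<Rightarrow> \<exists>\<theta>. diff_form A j \<theta> \<and> \<omega> = ext_d j \<theta>)"

definition cohomologous ::
  "('m, 'e::euclidean_space) chart set \<Rightarrow> nat \<Rightarrow> (('m, 'e) form \<times> ('m, 'e) form) set" where
  "cohomologous A k = {(\<omega>, \<eta>). closed_form A k \<omega> \<and> closed_form A k \<eta> \<and>
     exact_form A k (\<lambda>c x vs. \<omega> c x vs - \<eta> c x vs)}"

definition de_Rham ::
  "('m, 'e::euclidean_space) chart set \<Rightarrow> nat \<Rightarrow> ('m, 'e) form set set" where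
  "de_Rham A k = {\<omega>. closed_form A k \<omega>} // cohomologous A k"

definition de_Rham_class ::
  "('m, 'e::euclidean_space) chart set \<Rightarrow> nat \<Rightarrow> ('m, 'e) form \<Rightarrow> ('m, 'e) form set" where
  "de_Rham_class A k \<omega> = cohomologous A k `` {\<omega>}"

definition de_Rham_zero ::
  "('m, 'e::euclidean_space) chart set \<Rightarrow> nat \<Rightarrow> ('m, 'e) form set" where
  "de_Rham_zero A k = de_Rham_class A k zero_form"


text \<open>
  Transversely oriented codimension one foliations, given by an atlas of foliated charts.
  In a foliated chart the coordinate along one fixed basis vector is the transverse one:
  the plaques are its level sets, and it increases in the positive transverse direction.
\<close>

definition transverse_axis :: "'e::euclidean_space" where
  "transverse_axis = (SOME b. b \<in> Basis)"

definition transverse_coord :: "('m, 'e::euclidean_space) chart \<Rightarrow> 'm \<Rightarrow> real" where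
  "transverse_coord c p = chart_map c p \<bullet> transverse_axis"

definition oriented_foliation ::
  "('m::topological_space, 'e::euclidean_space) chart set \<Rightarrow> ('m, 'e) chart set \<Rightarrow> bool" where
  "oriented_foliation A F \<longleftrightarrow>
     F \<subseteq> A \<and>
     (\<Union>c\<in>F. chart_dom c) = UNIV \<and>
     (\<forall>c\<in>F. \<forall>c'\<in>F. \<forall>p\<in>chart_dom c \<inter> chart_dom c'.
        \<exists>W J. \<exists>h :: real \<Rightarrow> real.
          open W \<and> p \<in> W \<and> W \<subseteq> chart_dom c \<inter> chart_dom c' \<and>
          open J \<and> smooth_on J h \<and> (\<forall>s\<in>J. deriv h s > 0) \<and>
          (\<forall>q\<in>W. transverse_coord c q \<in> J \<and>
             transverse_coord c' q = h (transverse_coord c q)))"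

text \<open>
  The pullback foliation: its plaques are the preimages of plaques, and its transverse
  orientation is the one that the diffeomorphism f carries to the given one.
\<close>

definition pullback_foliation :: "('m \<Rightarrow> 'm) \<Rightarrow> ('m, 'e) chart set \<Rightarrow> ('m, 'e) chart set" where
  "pullback_foliation f F = (\<lambda>c. (f -` chart_dom c, chart_map c \<circ> f)) ` F"

text \<open>
  A 1-form defines the foliation if its kernel is the tangent space of the leaf at each
  point and it is positive on positively oriented transverse vectors; in particular it vanishes
  nowhere. Foliated charts are charts of the atlas, so this can be read off in them.
\<close>

definition defining_form ::
  "('m, 'e::euclidean_space) chart set \<Rightarrow> ('m, 'e) chart set \<Rightarrow> ('m, 'e) form \<Rightarrow> bool" where
  "defining_form A F \<alpha> \<longleftrightarrow> diff_form A 1 \<alpha> \<and>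
     (\<forall>c\<in>F. \<forall>x\<in>chart_ran c. \<forall>v.
        (\<alpha> c x [v] = 0 \<longleftrightarrow> v \<bullet> transverse_axis = 0) \<and>
        (v \<bullet> transverse_axis > 0 \<longrightarrow> \<alpha> c x [v] > 0))"

text \<open>
  The smooth families of forms from which the class TGV of a family F of foliations is computed,
  with d \<alpha> = \<alpha> \<and> \<beta>. The class does not depend on the choice of such a pair, so a statement on
  the TGV class of F is a statement on TGV A \<beta> t for every adapted pair.
\<close>

definition adapted_forms ::
  "('m, 'e::euclidean_space) chart set \<Rightarrow> real set \<Rightarrow> (real \<Rightarrow> ('m, 'e) chart set) \<Rightarrow>
   (real \<Rightarrow> ('m, 'e) form) \<Rightarrow> (real \<Rightarrow> ('m, 'e) form) \<Rightarrow> bool" where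
  "adapted_forms A I F \<alpha> \<beta> \<longleftrightarrow>
     smooth_form_family A I 1 \<alpha> \<and> smooth_form_family A I 1 \<beta> \<and>
     (\<forall>t\<in>I. defining_form A (F t) (\<alpha> t) \<and> ext_d 1 (\<alpha> t) = wedge 1 1 (\<alpha> t) (\<beta> t))"

definition TGV_form :: "(real \<Rightarrow> ('m, 'e::euclidean_space) form) \<Rightarrow> real \<Rightarrow> ('m, 'e) form" where
  "TGV_form \<beta> t = wedge 2 2 (wedge 1 1 (dot \<beta> t) (\<beta> t)) (ext_d 1 (\<beta> t))"

definition TGV ::
  "('m, 'e::euclidean_space) chart set \<Rightarrow> (real \<Rightarrow> ('m, 'e) form) \<Rightarrow> real \<Rightarrow> ('m, 'e) form set" where
  "TGV A \<beta> t = de_Rham_class A 4 (TGV_form \<beta> t)"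

end

theory Submission
  imports Defs
begin

text \<open>
  Why the class vanishes. Let \<open>X\<close> be the time-dependent vector field along which the pulled back foliations
  move. A form \<open>\<alpha>(t)\<close> defining the pulled back foliation differs from the pullback of a fixed defining form
  only by a positive function, so its derivative in \<open>t\<close> is the Lie derivative along \<open>X\<close> up to a multiple of
  \<open>\<alpha>\<close>. With \<open>\<phi> = \<alpha>(X)\<close> and \<open>d\<alpha> = \<alpha> \<and> \<beta>\<close>, Cartan's formula turns this into
  \<open>\<alpha>' = \<phi> \<beta> + d\<phi> - \<mu> \<alpha>\<close>  for a unique function \<open>\<mu>\<close>, where the prime is the derivative in \<open>t\<close>. Differentiating
  this equation, and using the derivative of \<open>d\<alpha> = \<alpha> \<and> \<beta>\<close> in \<open>t\<close>, gives
  \<open>\<alpha> \<and> (\<beta>' - d\<mu>) = \<phi> d\<beta>\<close>.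

  The rest is linear algebra at a point. From \<open>d(d\<alpha>) = 0\<close> follows \<open>\<alpha> \<and> d\<beta> = 0\<close>, so that \<open>d\<beta> = \<alpha> \<and> \<gamma>\<close> for a
  covector \<open>\<gamma>\<close>, and \<open>\<beta>' - d\<mu>\<close> is a combination of \<open>\<alpha>\<close> and \<open>\<gamma>\<close>. Therefore \<open>(\<beta>' - d\<mu>) \<and> \<beta> \<and> d\<beta> = 0\<close> and
  \<open>d\<beta> \<and> d\<beta> = 0\<close>, and consequently
  \<open>\<beta>' \<and> \<beta> \<and> d\<beta> = d\<mu> \<and> \<beta> \<and> d\<beta> = d(\<mu> \<beta> \<and> d\<beta>)\<close>.
  This argument, which holds for every pair of families for which a function \<open>\<phi>\<close> with the displayed
  property exists, is \<open>TGV_zero_if_variation\<close>.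

  The vector field itself is avoided. If \<open>f\<close> is the transverse coordinate of a fixed foliated chart composed with
  the diffeomorphism at time \<open>t\<close>, then \<open>\<alpha> = g df\<close> near a point, and \<open>\<phi>\<close> is \<open>g\<close> times the time derivative of
  \<open>f\<close>. Another foliated chart replaces \<open>f\<close> by \<open>h(f)\<close> with \<open>h\<close> independent of \<open>t\<close>, which multiplies the derivatives of \<open>f\<close>
  in time and space by the same factor; so these local functions agree and define \<open>\<phi>\<close> on the whole manifold
  (\<open>transverse_velocity\<close>). The formula for \<open>\<alpha>'\<close> then is a computation with \<open>f\<close> and \<open>g\<close>
  (\<open>variation_of_defining_form\<close>).
\<close>

section \<open>Directional derivatives and smooth maps\<close>

abbreviation dir_deriv :: "('a::real_normed_vector \<Rightarrow> 'b::real_normed_vector) \<Rightarrow> 'a \<Rightarrow> 'a \<Rightarrow> 'b" where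
  "dir_deriv f v x \<equiv> frechet_derivative f (at x) v"

lemma dir_deriv_eqI: "(f has_derivative f') (at x) \<Longrightarrow> dir_deriv f v x = f' v"
  using frechet_derivative_at by metis

lemma dir_deriv_cong:
  assumes "open S" "x \<in> S" "\<And>y. y \<in> S \<Longrightarrow> f y = g y"
  shows "dir_deriv f v x = dir_deriv g v x"
proof -
  have "(f has_derivative D) (at x) \<longleftrightarrow> (g has_derivative D) (at x)" for D
    using has_derivative_transform_within_open[of f D x UNIV S g]
      has_derivative_transform_within_open[of g D x UNIV S f] assms by auto
  then show ?thesis by (simp add: frechet_derivative_def)
qed

lemma differentiable_cong_open:
  assumes "open S" "x \<in> S" "\<And>y. y \<in> S \<Longrightarrow> f y = g y" "f differentiable (at x)"
  shows "g differentiable (at x)"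
  using assms has_derivative_transform_within_open[of f _ x UNIV S g]
  unfolding differentiable_def by blast

lemma dir_deriv_works:
  "f differentiable (at x) \<Longrightarrow> (f has_derivative (\<lambda>v. dir_deriv f v x)) (at x)"
  by (simp add: frechet_derivative_works)

lemma class_C_on_cong:
  assumes "open S" "\<And>x. x \<in> S \<Longrightarrow> f x = g x" "class_C_on n S f"
  shows "class_C_on n S g"
  using assms(2,3)
proof (induction n arbitrary: f g)
  case 0
  then show ?case using continuous_on_cong[of S S f g] by simp
next
  case (Suc n)
  have "class_C_on n S (\<lambda>x. dir_deriv g v x)" for v
  proof (rule Suc.IH)
    show "class_C_on n S (\<lambda>x. dir_deriv f v x)" using Suc.prems by simp
    show "dir_deriv f v x = dir_deriv g v x" if "x \<in> S" for x
      using dir_deriv_cong[OF assms(1) that, of f g] Suc.prems(1) by blast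
  qed
  moreover have "g differentiable (at x)" if "x \<in> S" for x
    using differentiable_cong_open[OF assms(1) that Suc.prems(1)] Suc.prems(2) that by simp
  ultimately show ?case by simp
qed

lemma class_C_on_imp_continuous_on: "class_C_on n S f \<Longrightarrow> continuous_on S f"
  by (cases n) (auto intro!: continuous_at_imp_continuous_on differentiable_imp_continuous_within)

lemma class_C_on_Suc_imp: "class_C_on (Suc n) S f \<Longrightarrow> class_C_on n S f"
proof (induction n arbitrary: f)
  case 0
  then show ?case using class_C_on_imp_continuous_on[of "Suc 0"] by (simp del: class_C_on.simps(2))
next
  case (Suc n)
  then have "class_C_on (Suc n) S (\<lambda>x. dir_deriv f v x)" for v
    by (simp only: class_C_on.simps(2)[of "Suc n"])
  with Suc show ?case by (simp only: class_C_on.simps(2)) blast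
qed

lemma class_C_on_subset: "class_C_on n S f \<Longrightarrow> T \<subseteq> S \<Longrightarrow> class_C_on n T f"
  by (induction n arbitrary: f) (auto intro: continuous_on_subset)

lemma class_C_on_locally:
  assumes "\<And>x. x \<in> S \<Longrightarrow> \<exists>U. open U \<and> x \<in> U \<and> class_C_on n U f"
  shows "class_C_on n S f"
  using assms
proof (induction n arbitrary: f)
  case 0
  have "isCont f x" if "x \<in> S" for x
    using 0[OF that] by (auto simp: continuous_on_eq_continuous_at)
  then show ?case by (simp add: continuous_at_imp_continuous_on)
next
  case (Suc n)
  have "class_C_on n S (\<lambda>x. dir_deriv f v x)" for v
  proof (rule Suc.IH)
    show "\<exists>U. open U \<and> x \<in> U \<and> class_C_on n U (\<lambda>x. dir_deriv f v x)" if "x \<in> S" for x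
      using Suc.prems[OF that] by auto
  qed
  moreover have "f differentiable (at x)" if "x \<in> S" for x
    using Suc.prems[OF that] by auto
  ultimately show ?case by simp
qed

lemma class_C_on_const: "class_C_on n S (\<lambda>x. c)"
  by (induction n arbitrary: c) auto

lemma class_C_on_add:
  assumes "open S" "class_C_on n S f" "class_C_on n S g"
  shows "class_C_on n S (\<lambda>x. f x + g x)"
  using assms(2,3)
proof (induction n arbitrary: f g)
  case 0
  then show ?case by (simp add: continuous_on_add)
next
  case (Suc n)
  have "class_C_on n S (\<lambda>x. dir_deriv (\<lambda>x. f x + g x) v x)" for v
  proof (rule class_C_on_cong[OF assms(1)])
    show "class_C_on n S (\<lambda>x. dir_deriv f v x + dir_deriv g v x)" using Suc by simp
    show "dir_deriv f v x + dir_deriv g v x = dir_deriv (\<lambda>x. f x + g x) v x" if "x \<in> S" for x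
      by (rule sym, rule dir_deriv_eqI)
        (use Suc.prems that in \<open>auto intro!: has_derivative_add dir_deriv_works\<close>)
  qed
  with Suc.prems show ?case by simp
qed

lemma class_C_on_linear:
  assumes "open S" "bounded_linear L" "class_C_on n S f"
  shows "class_C_on n S (\<lambda>x. L (f x))"
  using assms(3)
proof (induction n arbitrary: f)
  case 0
  then show ?case by (simp add: bounded_linear.continuous_on[OF assms(2)])
next
  case (Suc n)
  have *: "((\<lambda>x. L (f x)) has_derivative (\<lambda>v. L (dir_deriv f v x))) (at x)" if "x \<in> S" for x
    by (rule bounded_linear.has_derivative[OF assms(2)])
       (use Suc.prems that in \<open>auto intro!: dir_deriv_works\<close>)
  have "class_C_on n S (\<lambda>x. dir_deriv (\<lambda>x. L (f x)) v x)" for v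
  proof (rule class_C_on_cong[OF assms(1)])
    show "class_C_on n S (\<lambda>x. L (dir_deriv f v x))" using Suc by simp
    show "L (dir_deriv f v x) = dir_deriv (\<lambda>x. L (f x)) v x" if "x \<in> S" for x
      by (rule sym, rule dir_deriv_eqI, rule *[OF that])
  qed
  moreover have "(\<lambda>x. L (f x)) differentiable (at x)" if "x \<in> S" for x
    using *[OF that] by (auto simp: differentiable_def)
  ultimately show ?case by simp
qed

lemma class_C_on_mult:
  fixes f g :: "'a::real_normed_vector \<Rightarrow> real"
  assumes "open S" "class_C_on n S f" "class_C_on n S g"
  shows "class_C_on n S (\<lambda>x. f x * g x)"
  using assms(2,3)
proof (induction n arbitrary: f g)
  case 0
  then show ?case by (simp add: continuous_on_mult)
next
  case (Suc n)
  have "class_C_on n S (\<lambda>x. dir_deriv (\<lambda>x. f x * g x) v x)" for v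
  proof (rule class_C_on_cong[OF assms(1)])
    show "class_C_on n S (\<lambda>x. f x * dir_deriv g v x + dir_deriv f v x * g x)"
      using Suc.prems class_C_on_Suc_imp[OF Suc.prems(1)] class_C_on_Suc_imp[OF Suc.prems(2)]
      by (intro class_C_on_add[OF assms(1)] Suc.IH) auto
    show "f x * dir_deriv g v x + dir_deriv f v x * g x = dir_deriv (\<lambda>x. f x * g x) v x"
      if "x \<in> S" for x
      by (rule sym, rule dir_deriv_eqI)
        (use Suc.prems that in \<open>auto intro!: has_derivative_mult dir_deriv_works\<close>)
  qed
  with Suc.prems show ?case by simp
qed

lemma class_C_on_inverse:
  fixes f :: "'a::real_normed_vector \<Rightarrow> real"
  assumes "open S" "class_C_on n S f" "\<And>x. x \<in> S \<Longrightarrow> f x \<noteq> 0"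
  shows "class_C_on n S (\<lambda>x. inverse (f x))"
  using assms(2)
proof (induction n)
  case 0
  then show ?case using assms(3) by (simp add: continuous_on_inverse)
next
  case (Suc n)
  have inv: "class_C_on n S (\<lambda>x. inverse (f x))"
    using Suc class_C_on_Suc_imp by blast
  have *: "((\<lambda>x. inverse (f x)) has_derivative
      (\<lambda>v. - (inverse (f x) * dir_deriv f v x * inverse (f x)))) (at x)" if "x \<in> S" for x
    by (rule Deriv.has_derivative_inverse) (use assms(3) Suc.prems that in \<open>auto intro!: dir_deriv_works\<close>)
  have "class_C_on n S (\<lambda>x. dir_deriv (\<lambda>x. inverse (f x)) v x)" for v
  proof (rule class_C_on_cong[OF assms(1)])
    show "class_C_on n S (\<lambda>x. - (inverse (f x) * dir_deriv f v x * inverse (f x)))"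
      using Suc.prems inv
      by (intro class_C_on_linear[OF assms(1) bounded_linear_minus[OF bounded_linear_ident]]
          class_C_on_mult[OF assms(1)]) auto
    show "- (inverse (f x) * dir_deriv f v x * inverse (f x)) = dir_deriv (\<lambda>x. inverse (f x)) v x"
      if "x \<in> S" for x
      by (rule sym, rule dir_deriv_eqI, rule *[OF that])
  qed
  moreover have "(\<lambda>x. inverse (f x)) differentiable (at x)" if "x \<in> S" for x
    using *[OF that] by (auto simp: differentiable_def)
  ultimately show ?case by simp
qed

lemma smooth_on_cong:
  assumes "open S" "\<And>x. x \<in> S \<Longrightarrow> f x = g x" "smooth_on S f"
  shows "smooth_on S g"
  using class_C_on_cong[OF assms(1,2)] assms(3) by (simp add: smooth_on_def)

lemma smooth_on_subset: "smooth_on S f \<Longrightarrow> T \<subseteq> S \<Longrightarrow> smooth_on T f"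
  using class_C_on_subset[of _ S f T] by (simp add: smooth_on_def)

lemma smooth_on_locally:
  assumes "\<And>x. x \<in> S \<Longrightarrow> \<exists>U. open U \<and> x \<in> U \<and> smooth_on U f"
  shows "smooth_on S f"
  unfolding smooth_on_def
proof
  show "class_C_on n S f" for n
  proof (rule class_C_on_locally)
    show "\<exists>U. open U \<and> x \<in> U \<and> class_C_on n U f" if "x \<in> S" for x
      using assms[OF that] unfolding smooth_on_def by blast
  qed
qed

lemma smooth_on_const: "smooth_on S (\<lambda>x. c)"
  by (simp add: smooth_on_def class_C_on_const)

lemma smooth_on_add:
  "open S \<Longrightarrow> smooth_on S f \<Longrightarrow> smooth_on S g \<Longrightarrow> smooth_on S (\<lambda>x. f x + g x)"
  by (simp add: smooth_on_def class_C_on_add)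

lemma smooth_on_linear:
  "open S \<Longrightarrow> bounded_linear L \<Longrightarrow> smooth_on S f \<Longrightarrow> smooth_on S (\<lambda>x. L (f x))"
  by (simp add: smooth_on_def class_C_on_linear)

lemma smooth_on_diff:
  "open S \<Longrightarrow> smooth_on S f \<Longrightarrow> smooth_on S g \<Longrightarrow> smooth_on S (\<lambda>x. f x - g x)"
  using smooth_on_add[of S f "\<lambda>x. - g x"]
    smooth_on_linear[OF _ bounded_linear_minus[OF bounded_linear_ident], of S g] by simp

lemma smooth_on_mult:
  fixes f g :: "'a::real_normed_vector \<Rightarrow> real"
  shows "open S \<Longrightarrow> smooth_on S f \<Longrightarrow> smooth_on S g \<Longrightarrow> smooth_on S (\<lambda>x. f x * g x)"
  by (simp add: smooth_on_def class_C_on_mult)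

lemma smooth_on_divide:
  fixes f g :: "'a::real_normed_vector \<Rightarrow> real"
  shows "open S \<Longrightarrow> smooth_on S f \<Longrightarrow> smooth_on S g \<Longrightarrow> (\<And>x. x \<in> S \<Longrightarrow> g x \<noteq> 0)
    \<Longrightarrow> smooth_on S (\<lambda>x. f x / g x)"
  by (simp add: divide_inverse smooth_on_def class_C_on_mult class_C_on_inverse)

lemma smooth_on_sum:
  assumes "open S" "\<And>i. i \<in> K \<Longrightarrow> smooth_on S (f i)"
  shows "smooth_on S (\<lambda>x. \<Sum>i\<in>K. f i x)"
  using assms(2)
  by (induction K rule: infinite_finite_induct) (auto simp: smooth_on_const smooth_on_add[OF assms(1)])

lemma smooth_on_class_C: "smooth_on S f \<Longrightarrow> class_C_on n S f"
  by (simp add: smooth_on_def)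

lemma smooth_on_dir_deriv: "smooth_on S f \<Longrightarrow> smooth_on S (\<lambda>x. dir_deriv f v x)"
  unfolding smooth_on_def[of S "\<lambda>x. dir_deriv f v x"]
  using smooth_on_class_C[of S f "Suc n" for n] by simp

lemma smooth_on_differentiable: "smooth_on S f \<Longrightarrow> x \<in> S \<Longrightarrow> f differentiable (at x)"
  using smooth_on_class_C[of S f "Suc 0"] by simp

lemma smooth_on_continuous_on: "smooth_on S f \<Longrightarrow> continuous_on S f"
  using smooth_on_class_C[of S f 0] by simp

section \<open>Symmetry of second derivatives\<close>

text \<open>
  The mean value theorem, applied in the direction \<open>u\<close> and then in the direction \<open>v\<close>. The left hand side is
  symmetric in \<open>u\<close> and \<open>v\<close>, so that exchanging them expresses it by the other mixed derivative.
\<close>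

lemma mixed_difference:
  fixes f :: "'a::real_normed_vector \<Rightarrow> real"
  assumes h: "h > 0"
    and P: "\<And>r s. 0 \<le> r \<Longrightarrow> r \<le> h \<Longrightarrow> 0 \<le> s \<Longrightarrow> s \<le> h \<Longrightarrow> x + r *\<^sub>R u + s *\<^sub>R v \<in> S"
    and f: "\<And>y. y \<in> S \<Longrightarrow> f differentiable (at y)"
    and fu: "\<And>y. y \<in> S \<Longrightarrow> (\<lambda>z. dir_deriv f u z) differentiable (at y)"
  shows "\<exists>r s. 0 < r \<and> r < h \<and> 0 < s \<and> s < h \<and>
    f (x + h *\<^sub>R u + h *\<^sub>R v) - f (x + h *\<^sub>R u) - f (x + h *\<^sub>R v) + f x =
    h * h * dir_deriv (\<lambda>z. dir_deriv f u z) v (x + r *\<^sub>R u + s *\<^sub>R v)"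
proof -
  have line: "((\<lambda>r. g (y + r *\<^sub>R w)) has_real_derivative dir_deriv g w (y + r *\<^sub>R w)) (at r)"
    if "g differentiable (at (y + r *\<^sub>R w))" for g :: "'a \<Rightarrow> real" and y w r
  proof -
    have "((\<lambda>r. g (y + r *\<^sub>R w)) has_derivative (\<lambda>d. dir_deriv g (d *\<^sub>R w) (y + r *\<^sub>R w))) (at r)"
      by (rule has_derivative_compose[where f = "\<lambda>r. y + r *\<^sub>R w" and g = g, OF _ dir_deriv_works[OF that]])
        (auto intro!: derivative_eq_intros)
    moreover have "dir_deriv g (d *\<^sub>R w) (y + r *\<^sub>R w) = d * dir_deriv g w (y + r *\<^sub>R w)" for d
      using linear_scale[OF linear_frechet_derivative[OF that]] by simp
    ultimately show ?thesis
      by (simp add: has_field_derivative_def mult_commute_abs)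
  qed
  let ?k = "\<lambda>r. f ((x + h *\<^sub>R v) + r *\<^sub>R u) - f (x + r *\<^sub>R u)"
  have "DERIV ?k r :> dir_deriv f u ((x + h *\<^sub>R v) + r *\<^sub>R u) - dir_deriv f u (x + r *\<^sub>R u)"
    if "0 \<le> r" "r \<le> h" for r
  proof -
    have "(x + h *\<^sub>R v) + r *\<^sub>R u \<in> S" "x + r *\<^sub>R u \<in> S"
      using P[of r h] P[of r 0] that h by (simp_all add: add.assoc add.commute[of "h *\<^sub>R v"])
    then show ?thesis
      by (intro DERIV_diff line[of f "x + h *\<^sub>R v" r u] line[of f x r u] f)
  qed
  from MVT2[OF h this] obtain r where r: "0 < r" "r < h" and
    req: "?k h - ?k 0 = h * (dir_deriv f u ((x + h *\<^sub>R v) + r *\<^sub>R u) - dir_deriv f u (x + r *\<^sub>R u))"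
    by auto
  let ?l = "\<lambda>s. dir_deriv f u ((x + r *\<^sub>R u) + s *\<^sub>R v)"
  have "DERIV ?l s :> dir_deriv (\<lambda>z. dir_deriv f u z) v ((x + r *\<^sub>R u) + s *\<^sub>R v)"
    if "0 \<le> s" "s \<le> h" for s
  proof (rule line[of "\<lambda>z. dir_deriv f u z" "x + r *\<^sub>R u" s v], rule fu)
    show "x + r *\<^sub>R u + s *\<^sub>R v \<in> S" using P[of r s] that r by simp
  qed
  from MVT2[OF h this] obtain s where s: "0 < s" "s < h" and
    "?l h - ?l 0 = h * dir_deriv (\<lambda>z. dir_deriv f u z) v ((x + r *\<^sub>R u) + s *\<^sub>R v)"
    by auto
  with req r show ?thesis
    by (intro exI[of _ r] exI[of _ s]) (simp add: algebra_simps)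
qed

text \<open>
  On every small parallelogram at \<open>x\<close> the two mixed derivatives have a common value, each at a point of its own.
  Both are continuous, so that shrinking the parallelogram identifies their values at \<open>x\<close>.
\<close>

lemma symmetric_second_derivative:
  fixes f :: "'a::real_normed_vector \<Rightarrow> real"
  assumes S: "open S" "x \<in> S" and f: "smooth_on S f"
  shows "dir_deriv (\<lambda>z. dir_deriv f u z) v x = dir_deriv (\<lambda>z. dir_deriv f v z) u x"
proof (rule ccontr)
  let ?a = "\<lambda>z. dir_deriv (\<lambda>z. dir_deriv f u z) v z" and ?b = "\<lambda>z. dir_deriv (\<lambda>z. dir_deriv f v z) u z"
  assume ne: "?a x \<noteq> ?b x"
  define \<epsilon> where "\<epsilon> = \<bar>?a x - ?b x\<bar> / 2"
  have \<epsilon>: "\<epsilon> > 0" using ne by (simp add: \<epsilon>_def)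
  have "continuous_on S ?a" "continuous_on S ?b"
    by (intro smooth_on_continuous_on smooth_on_dir_deriv f)+
  then have "isCont ?a x" "isCont ?b x"
    using S by (auto simp: continuous_on_eq_continuous_at)
  then obtain d1 d2 where d: "d1 > 0" "d2 > 0"
    "\<And>y. dist y x < d1 \<Longrightarrow> dist (?a y) (?a x) < \<epsilon>" "\<And>y. dist y x < d2 \<Longrightarrow> dist (?b y) (?b x) < \<epsilon>"
    using \<epsilon> unfolding continuous_at_eps_delta by metis
  obtain d3 where d3: "d3 > 0" "ball x d3 \<subseteq> S" using S open_contains_ball by blast
  define \<delta> where "\<delta> = min d1 (min d2 d3)"
  \<comment> \<open>The summand 1 keeps the denominator positive when \<open>u\<close> and \<open>v\<close> vanish.\<close>
  define h where "h = \<delta> / (2 * (norm u + norm v + 1))"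
  have \<delta>: "\<delta> > 0" using d d3 by (simp add: \<delta>_def)
  have n: "norm u + norm v + 1 > 0" by (simp add: add_nonneg_pos)
  have h: "h > 0" using \<delta> n by (simp add: h_def)
  have near: "dist (x + r *\<^sub>R u + s *\<^sub>R v) x < \<delta>" if "0 \<le> r" "r \<le> h" "0 \<le> s" "s \<le> h" for r s
  proof -
    have "dist (x + r *\<^sub>R u + s *\<^sub>R v) x \<le> norm (r *\<^sub>R u) + norm (s *\<^sub>R v)"
      by (simp add: dist_norm) (metis norm_triangle_ineq norm_scaleR)
    also have "\<dots> \<le> h * norm u + h * norm v"
      using that by (intro add_mono) (auto intro!: mult_right_mono)
    also have "\<dots> \<le> h * (norm u + norm v + 1)" using h by (simp add: algebra_simps)
    also have "\<dots> = \<delta> / 2" using n by (simp add: h_def field_simps)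
    also have "\<dots> < \<delta>" using \<delta> by simp
    finally show ?thesis .
  qed
  have inS: "x + r *\<^sub>R u + s *\<^sub>R v \<in> S" if "0 \<le> r" "r \<le> h" "0 \<le> s" "s \<le> h" for r s
    using near[OF that] d3 by (auto simp: \<delta>_def dist_commute mem_ball)
  obtain r s where rs: "0 < r" "r < h" "0 < s" "s < h"
    "f (x + h *\<^sub>R u + h *\<^sub>R v) - f (x + h *\<^sub>R u) - f (x + h *\<^sub>R v) + f x
      = h * h * ?a (x + r *\<^sub>R u + s *\<^sub>R v)"
    using mixed_difference[OF h inS smooth_on_differentiable[OF f]
      smooth_on_differentiable[OF smooth_on_dir_deriv[OF f]]] by auto
  have inS': "x + r *\<^sub>R v + s *\<^sub>R u \<in> S" if "0 \<le> r" "r \<le> h" "0 \<le> s" "s \<le> h" for r s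
    using inS[of s r] that by (simp add: algebra_simps)
  obtain r' s' where rs': "0 < r'" "r' < h" "0 < s'" "s' < h"
    "f (x + h *\<^sub>R v + h *\<^sub>R u) - f (x + h *\<^sub>R v) - f (x + h *\<^sub>R u) + f x
      = h * h * ?b (x + r' *\<^sub>R v + s' *\<^sub>R u)"
    using mixed_difference[OF h inS' smooth_on_differentiable[OF f]
      smooth_on_differentiable[OF smooth_on_dir_deriv[OF f]]] by auto
  have sw: "x + h *\<^sub>R v + h *\<^sub>R u = x + h *\<^sub>R u + h *\<^sub>R v" by simp
  have "h * h * ?a (x + r *\<^sub>R u + s *\<^sub>R v) = h * h * ?b (x + r' *\<^sub>R v + s' *\<^sub>R u)"
    unfolding rs(5)[symmetric] rs'(5)[symmetric] sw by simp
  then have eq: "?a (x + r *\<^sub>R u + s *\<^sub>R v) = ?b (x + r' *\<^sub>R v + s' *\<^sub>R u)" using h by simp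
  have "dist (?a (x + r *\<^sub>R u + s *\<^sub>R v)) (?a x) < \<epsilon>"
    using near[of r s] rs by (intro d) (simp add: \<delta>_def)
  moreover have "dist (?b (x + r' *\<^sub>R v + s' *\<^sub>R u)) (?b x) < \<epsilon>"
    using near[of s' r'] rs' by (intro d) (simp add: \<delta>_def algebra_simps)
  ultimately show False
    unfolding eq \<epsilon>_def dist_real_def by (simp add: abs_if split: if_splits)
qed

section \<open>Functions of time and space\<close>

lemma dir_deriv_slice:
  assumes "F differentiable (at (t, x))"
  shows "((\<lambda>y. F (t, y)) has_derivative (\<lambda>v. dir_deriv F (0, v) (t, x))) (at x)"
proof -
  have "((\<lambda>y. (t, y)) has_derivative (\<lambda>v. (0, v))) (at x)"
    by (intro has_derivative_Pair has_derivative_const has_derivative_ident)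
  from has_derivative_compose[OF this dir_deriv_works[OF assms]] show ?thesis .
qed

lemma deriv_slice:
  fixes F :: "real \<times> 'a::real_normed_vector \<Rightarrow> real"
  assumes "F differentiable (at (t, x))"
  shows "((\<lambda>s. F (s, x)) has_real_derivative dir_deriv F (1, 0) (t, x)) (at t)"
proof -
  have "((\<lambda>s. (s, x)) has_derivative (\<lambda>d. (d, 0))) (at t)"
    by (intro has_derivative_Pair has_derivative_const has_derivative_ident)
  from has_derivative_compose[OF this dir_deriv_works[OF assms]]
  have "((\<lambda>s. F (s, x)) has_derivative (\<lambda>d. dir_deriv F (d, 0) (t, x))) (at t)" .
  moreover have "(\<lambda>d. dir_deriv F (d, 0) (t, x)) = (*) (dir_deriv F (1, 0) (t, x))"
  proof
    show "dir_deriv F (d, 0) (t, x) = dir_deriv F (1, 0) (t, x) * d" for d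
      using linear_scale[OF linear_frechet_derivative[OF assms], of d "(1, 0)"]
      by (simp only: scaleR_Pair) simp
  qed
  ultimately show ?thesis by (simp only: has_field_derivative_def)
qed

lemma class_C_on_slice:
  assumes "open U" "class_C_on n U F" "\<And>x. x \<in> S \<Longrightarrow> (t, x) \<in> U" "open S"
  shows "class_C_on n S (\<lambda>x. F (t, x))"
  using assms(2)
proof (induction n arbitrary: F)
  case 0
  have "continuous_on ((\<lambda>x. (t, x)) ` S) F"
    by (rule continuous_on_subset[of U]) (use 0 assms(3) in auto)
  then have "continuous_on S (F \<circ> (\<lambda>x. (t, x)))"
    by (intro continuous_on_compose continuous_intros)
  then show ?case by (simp add: comp_def)
next
  case (Suc n)
  have "class_C_on n S (\<lambda>x. dir_deriv (\<lambda>x. F (t, x)) v x)" for v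
  proof (rule class_C_on_cong[OF \<open>open S\<close>])
    show "class_C_on n S (\<lambda>x. dir_deriv F (0, v) (t, x))"
      by (rule Suc.IH) (use Suc.prems in simp)
    show "dir_deriv F (0, v) (t, x) = dir_deriv (\<lambda>x. F (t, x)) v x" if "x \<in> S" for x
      by (rule sym, rule dir_deriv_eqI, rule dir_deriv_slice) (use Suc.prems assms(3)[OF that] in simp)
  qed
  moreover have "(\<lambda>x. F (t, x)) differentiable (at x)" if "x \<in> S" for x
    by (rule differentiableI, rule dir_deriv_slice) (use Suc.prems assms(3)[OF that] in simp)
  ultimately show ?case by simp
qed

lemma smooth_on_slice:
  "open U \<Longrightarrow> smooth_on U F \<Longrightarrow> (\<And>x. x \<in> S \<Longrightarrow> (t, x) \<in> U) \<Longrightarrow> open S \<Longrightarrow> smooth_on S (\<lambda>x. F (t, x))"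
  by (simp add: smooth_on_def class_C_on_slice)

section \<open>The wedge product at a point\<close>

lemma wedge_1_1: "wedge 1 1 \<omega> \<eta> c x [a, b] = \<omega> c x [a] * \<eta> c x [b] - \<omega> c x [b] * \<eta> c x [a]"
proof -
  have "{..<1 + 1 :: nat} = {0, 1}" by auto
  then show ?thesis
    by (simp add: wedge_def sum_over_permutations_insert permutes_sing sign_compose permutation_swap_id
        sign_swap_id sign_id upt_rec numeral_2_eq_2)
qed

lemma wedge_0_1: "wedge 0 1 \<omega> \<eta> c x [a] = \<omega> c x [] * \<eta> c x [a]"
proof -
  have "{..<1 :: nat} = {0}" by auto
  then show ?thesis
    by (simp add: wedge_def permutes_sing sign_id upt_rec)
qed

lemma alternating_form_length: "alternating_form k f \<Longrightarrow> length vs \<noteq> k \<Longrightarrow> f vs = 0"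
  by (simp add: alternating_form_def)

lemma alternating_form_linear:
  "alternating_form k f \<Longrightarrow> length vs = k \<Longrightarrow> i < k \<Longrightarrow> linear (\<lambda>v. f (vs[i := v]))"
  unfolding alternating_form_def by blast

lemma alternating_form_repeat:
  "alternating_form k f \<Longrightarrow> length vs = k \<Longrightarrow> i < j \<Longrightarrow> j < k \<Longrightarrow> vs ! i = vs ! j \<Longrightarrow> f vs = 0"
  unfolding alternating_form_def by blast

lemma alternating_form_1_iff:
  "alternating_form 1 f \<longleftrightarrow> (\<forall>vs. length vs \<noteq> 1 \<longrightarrow> f vs = 0) \<and> linear (\<lambda>v. f [v])"
proof
  assume f: "alternating_form 1 f"
  show "(\<forall>vs. length vs \<noteq> 1 \<longrightarrow> f vs = 0) \<and> linear (\<lambda>v. f [v])"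
    using alternating_form_linear[OF f, of "[0]" 0] alternating_form_length[OF f] by simp
next
  assume "(\<forall>vs. length vs \<noteq> 1 \<longrightarrow> f vs = 0) \<and> linear (\<lambda>v. f [v])"
  moreover have "vs[i := v] = [v]" if "length vs = 1" "i < 1" for vs :: "'a list" and i v
    using that by (cases vs) auto
  ultimately show "alternating_form 1 f" by (simp add: alternating_form_def)
qed

lemma alternating_form_swap2:
  assumes "alternating_form 2 f"
  shows "f [a, b] = - f [b, a]"
proof -
  have z: "f [v, v] = 0" for v
    by (rule alternating_form_repeat[OF assms, of _ 0 1]) auto
  have l: "linear (\<lambda>v. f ([u, w][i := v]))" if "i < 2" for u w i
    by (rule alternating_form_linear[OF assms]) (use that in auto)
  have 0: "linear (\<lambda>v. f [v, w])" for w using l[of 0 w w] by simp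
  have 1: "linear (\<lambda>v. f [u, v])" for u using l[of 1 u u] by simp
  have "f [a + b, a + b] = f [a, a] + f [a, b] + f [b, a] + f [b, b]"
    using linear_add[OF 0, of a b "a + b"] linear_add[OF 1, of a a b] linear_add[OF 1, of b a b] by simp
  then show ?thesis using z by simp
qed

text \<open>
  Two permutations that differ by a transposition of the arguments of \<open>\<eta>\<close> contribute equally, because \<open>\<eta>\<close> is
  alternating; the denominator \<open>fact 1 * fact 2\<close> compensates for this. In degree \<open>(2, 2)\<close> four permutations
  contribute to each term.
\<close>

lemma wedge_1_2:
  assumes "alternating_form 2 (\<eta> c x)"
  shows "wedge 1 2 \<omega> \<eta> c x [a, b, d] =
    \<omega> c x [a] * \<eta> c x [b, d] - \<omega> c x [b] * \<eta> c x [a, d] + \<omega> c x [d] * \<eta> c x [a, b]"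
proof -
  note s = alternating_form_swap2[OF assms]
  have "{..<1 + 2 :: nat} = {0, Suc 0, Suc (Suc 0)}" by auto
  then show ?thesis
    using s[of d b] s[of d a] s[of b a]
    by (simp add: wedge_def sum_over_permutations_insert permutes_sing sign_compose permutation_compose
        permutation_swap_id sign_swap_id sign_id upt_rec fact_numeral algebra_simps
        add_divide_distrib diff_divide_distrib)
qed

lemma wedge_2_2:
  assumes "alternating_form 2 (\<omega> c x)" "alternating_form 2 (\<eta> c x)"
  shows "wedge 2 2 \<omega> \<eta> c x [a, b, d, e] =
      \<omega> c x [a, b] * \<eta> c x [d, e] - \<omega> c x [a, d] * \<eta> c x [b, e] + \<omega> c x [a, e] * \<eta> c x [b, d]
    + \<omega> c x [b, d] * \<eta> c x [a, e] - \<omega> c x [b, e] * \<eta> c x [a, d] + \<omega> c x [d, e] * \<eta> c x [a, b]"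
proof -
  note s = alternating_form_swap2[OF assms(1)] alternating_form_swap2[OF assms(2)]
  have "{..<2 + 2 :: nat} = {0, 1, 2, 3}" by auto
  moreover have "[0..<2] = [0, 1::nat]" "[2..<2+2] = [2,3::nat]" by (simp_all add: upt_rec)
  ultimately show ?thesis
    using s(1)[of b a] s(1)[of d a] s(1)[of d b] s(1)[of e a] s(1)[of e b] s(1)[of e d]
      s(2)[of b a] s(2)[of d a] s(2)[of d b] s(2)[of e a] s(2)[of e b] s(2)[of e d]
    by (simp add: wedge_def sum_over_permutations_insert permutes_sing sign_compose permutation_compose
        permutation_swap_id sign_swap_id sign_id fact_numeral algebra_simps
        add_divide_distrib diff_divide_distrib)
qed


text \<open>
  The wedge product of multilinear functions, without the dependence on chart and point, so that
  alternation is a statement on its two factors only.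
\<close>

definition wedge_at :: "nat \<Rightarrow> nat \<Rightarrow> ('e list \<Rightarrow> real) \<Rightarrow> ('e list \<Rightarrow> real) \<Rightarrow> 'e list \<Rightarrow> real" where
  "wedge_at k l f g vs =
    (if length vs = k + l then
       (\<Sum>\<sigma> | \<sigma> permutes {..<k + l}.
          of_int (sign \<sigma>) * f (map (\<lambda>i. vs ! \<sigma> i) [0..<k]) * g (map (\<lambda>i. vs ! \<sigma> i) [k..<k + l]))
       / (fact k * fact l)
     else 0)"

lemma wedge_eq_wedge_at: "wedge k l \<omega> \<eta> c x = wedge_at k l (\<omega> c x) (\<eta> c x)"
  by (simp add: wedge_def wedge_at_def fun_eq_iff)

text \<open>
  A permutation puts a given argument into exactly one of the two factors, whence linearity. If two
  arguments agree, composition with their transposition preserves the factors and changes the sign of the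
  permutation, so that the sum equals its negative.
\<close>

lemma alternating_form_wedge_at:
  assumes f: "alternating_form k f" and g: "alternating_form l g"
  shows "alternating_form (k + l) (wedge_at k l f g)"
  unfolding alternating_form_def
proof (intro conjI allI impI)
  fix vs :: "'a list" assume "length vs \<noteq> k + l"
  then show "wedge_at k l f g vs = 0" by (simp add: wedge_at_def)
next
  fix vs :: "'a list" and i
  assume "length vs = k + l \<and> i < k + l"
  then have len: "length vs = k + l" and i: "i < k + l" by auto
  let ?T = "\<lambda>\<sigma> v. of_int (sign \<sigma>) * f (map (\<lambda>j. vs[i := v] ! \<sigma> j) [0..<k])
      * g (map (\<lambda>j. vs[i := v] ! \<sigma> j) [k..<k + l])"
  have "linear (?T \<sigma>)" if \<sigma>: "\<sigma> permutes {..<k + l}" for \<sigma>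
  proof -
    \<comment> \<open>The position into which \<open>\<sigma>\<close> puts the argument with index \<open>i\<close>.\<close>
    define m where "m = inv \<sigma> i"
    have \<sigma>m: "\<sigma> m = i" unfolding m_def using permutes_inverses(1)[OF \<sigma>] .
    have m: "m < k + l" using permutes_in_image[OF permutes_inv[OF \<sigma>]] i by (simp add: m_def)
    have \<sigma>lt: "\<sigma> j < k + l \<longleftrightarrow> j < k + l" for j using permutes_in_image[OF \<sigma>, of j] by simp
    have \<sigma>eq: "\<sigma> j = i \<longleftrightarrow> j = m" for j using permutes_inj[OF \<sigma>] \<sigma>m by (auto dest: injD)
    have upd: "vs[i := v] ! \<sigma> j = (if j = m then v else vs ! \<sigma> j)" for v j
      using \<sigma>eq[of j] len i by (auto simp: nth_list_update)
    have mul: "linear (\<lambda>v. a * h v * b)" if "linear h" for a b and h :: "'a \<Rightarrow> real"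
      using that by (simp add: linear_iff algebra_simps)
    show ?thesis
    proof (cases "m < k")
      case True
      have 1: "map (\<lambda>j. vs[i := v] ! \<sigma> j) [0..<k] = (map (\<lambda>j. vs ! \<sigma> j) [0..<k])[m := v]" for v
        by (rule nth_equalityI) (use True m in \<open>auto simp: upd nth_list_update\<close>)
      have 2: "map (\<lambda>j. vs[i := v] ! \<sigma> j) [k..<k + l] = map (\<lambda>j. vs ! \<sigma> j) [k..<k + l]" for v
        by (rule nth_equalityI) (use True m in \<open>auto simp: upd nth_list_update\<close>)
      show ?thesis unfolding 1 2
        by (rule mul) (rule alternating_form_linear[OF f], use True in auto)
    next
      case False
      have 1: "map (\<lambda>j. vs[i := v] ! \<sigma> j) [0..<k] = map (\<lambda>j. vs ! \<sigma> j) [0..<k]" for v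
        by (rule nth_equalityI) (use False m in \<open>auto simp: upd nth_list_update\<close>)
      have 2: "map (\<lambda>j. vs[i := v] ! \<sigma> j) [k..<k + l] = (map (\<lambda>j. vs ! \<sigma> j) [k..<k + l])[m - k := v]" for v
        by (rule nth_equalityI) (use False m in \<open>auto simp: upd nth_list_update\<close>)
      have "linear (\<lambda>v. g ((map (\<lambda>j. vs ! \<sigma> j) [k..<k + l])[m - k := v]))"
        by (rule alternating_form_linear[OF g]) (use False m in auto)
      from mul[OF this, of _ 1] show ?thesis unfolding 1 2 by simp
    qed
  qed
  then have "linear (\<lambda>v. (\<Sum>\<sigma> | \<sigma> permutes {..<k + l}. ?T \<sigma> v))"
    by (intro linear_compose_sum) auto
  then have "linear (\<lambda>v. (\<Sum>\<sigma> | \<sigma> permutes {..<k + l}. ?T \<sigma> v) / (fact k * fact l))"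
    by (simp add: linear_iff add_divide_distrib)
  then show "linear (\<lambda>v. wedge_at k l f g (vs[i := v]))"
    using len by (simp add: wedge_at_def)
next
  fix vs :: "'a list" and i j
  assume "length vs = k + l \<and> i < j \<and> j < k + l \<and> vs ! i = vs ! j"
  then have len: "length vs = k + l" and ij: "i < j" "j < k + l" "vs ! i = vs ! j" by auto
  let ?T = "\<lambda>\<sigma>. of_int (sign \<sigma>) * f (map (\<lambda>m. vs ! \<sigma> m) [0..<k]) * g (map (\<lambda>m. vs ! \<sigma> m) [k..<k + l])"
  let ?\<tau> = "Transposition.transpose i j"
  have \<tau>: "?\<tau> permutes {..<k + l}"
    using ij by (intro permutes_swap_id) auto
  have "?T (?\<tau> \<circ> \<sigma>) = - ?T \<sigma>" if "\<sigma> permutes {..<k + l}" for \<sigma>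
  proof -
    have "vs ! ?\<tau> n = vs ! n" for n using ij(3) by (auto simp: Transposition.transpose_def)
    moreover have "sign (?\<tau> \<circ> \<sigma>) = - sign \<sigma>"
      using that ij permutation_permutes[of \<sigma>] permutation_swap_id[of i j]
      by (auto simp: sign_compose sign_swap_id)
    ultimately show ?thesis by simp
  qed
  then have "sum ?T {\<sigma>. \<sigma> permutes {..<k + l}} = - sum ?T {\<sigma>. \<sigma> permutes {..<k + l}}"
    using setum_permutations_compose_left[OF \<tau>, of ?T] by (simp add: sum_negf)
  then show "wedge_at k l f g vs = 0"
    by (simp add: wedge_at_def)
qed

section \<open>Charts and differential forms\<close>

lemma chart_ran_open: "is_chart c \<Longrightarrow> open (chart_ran c)"
  and chart_dom_open: "is_chart c \<Longrightarrow> open (chart_dom c)"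
  by (simp_all add: is_chart_def)

lemma chart_inv_chart_map: "is_chart c \<Longrightarrow> p \<in> chart_dom c \<Longrightarrow> chart_inv c (chart_map c p) = p"
  by (simp add: is_chart_def homeomorphism_def)

lemma chart_map_chart_inv: "x \<in> chart_ran c \<Longrightarrow> chart_map c (chart_inv c x) = x"
  and chart_inv_in_dom: "x \<in> chart_ran c \<Longrightarrow> chart_inv c x \<in> chart_dom c"
  by (simp_all add: chart_ran_def chart_inv_def f_inv_into_f inv_into_into)

lemma chart_map_in_ran: "p \<in> chart_dom c \<Longrightarrow> chart_map c p \<in> chart_ran c"
  by (simp add: chart_ran_def)

lemma chart_inv_continuous: "is_chart c \<Longrightarrow> continuous_on (chart_ran c) (chart_inv c)"
  by (simp add: is_chart_def homeomorphism_def)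

definition overlap :: "('m, 'e) chart \<Rightarrow> ('m, 'e) chart \<Rightarrow> 'e set" where
  "overlap c c' = chart_map c ` (chart_dom c \<inter> chart_dom c')"

lemma overlap_altdef:
  assumes "is_chart c"
  shows "overlap c c' = {x \<in> chart_ran c. chart_inv c x \<in> chart_dom c'}"
proof (intro equalityI subsetI)
  fix x assume "x \<in> overlap c c'"
  then show "x \<in> {x \<in> chart_ran c. chart_inv c x \<in> chart_dom c'}"
    using chart_inv_chart_map[OF assms] chart_map_in_ran[of _ c] by (auto simp: overlap_def)
next
  fix x assume "x \<in> {x \<in> chart_ran c. chart_inv c x \<in> chart_dom c'}"
  then have "x = chart_map c (chart_inv c x)" "chart_inv c x \<in> chart_dom c \<inter> chart_dom c'"
    using chart_map_chart_inv chart_inv_in_dom by fastforce+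
  then show "x \<in> overlap c c'" unfolding overlap_def by (rule image_eqI)
qed

lemma open_chart_preimage:
  assumes "is_chart c" "open U"
  shows "open {x \<in> chart_ran c. chart_inv c x \<in> U}"
proof -
  have "open (chart_ran c \<inter> chart_inv c -` U)"
    using continuous_open_preimage[OF chart_inv_continuous chart_ran_open] assms by blast
  moreover have "chart_ran c \<inter> chart_inv c -` U = {x \<in> chart_ran c. chart_inv c x \<in> U}" by auto
  ultimately show ?thesis by simp
qed

lemma open_overlap: "is_chart c \<Longrightarrow> is_chart c' \<Longrightarrow> open (overlap c c')"
  using open_chart_preimage[of c "chart_dom c'"] chart_dom_open[of c'] by (simp add: overlap_altdef)

abbreviation transition_deriv :: "('m, 'e::euclidean_space) chart \<Rightarrow> ('m, 'e) chart \<Rightarrow> 'e \<Rightarrow> 'e \<Rightarrow> 'e" where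
  "transition_deriv c c' x \<equiv> frechet_derivative (transition c c') (at x)"

locale smooth_atlas =
  fixes A :: "('m::{t2_space, second_countable_topology}, 'e::euclidean_space) chart set"
  assumes smooth_structure: "smooth_structure A"
begin

lemma is_chart: "c \<in> A \<Longrightarrow> is_chart c"
  using smooth_structure unfolding smooth_structure_def by blast

lemma transition_smooth:
  assumes "c \<in> A" "c' \<in> A"
  shows "smooth_on (overlap c c') (transition c c')"
proof -
  have "compatible c c'" using assms smooth_structure unfolding smooth_structure_def by blast
  then show ?thesis by (simp add: compatible_def overlap_def)
qed

lemma transition_in_ran: "c \<in> A \<Longrightarrow> x \<in> overlap c c' \<Longrightarrow> transition c c' x \<in> chart_ran c'"
  by (simp add: overlap_altdef[OF is_chart] transition_def chart_map_in_ran)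

lemma overlap_in_ran: "x \<in> overlap c c' \<Longrightarrow> x \<in> chart_ran c"
  by (auto simp: overlap_def chart_ran_def)

lemma transition_derivative:
  assumes "c \<in> A" "c' \<in> A" "x \<in> overlap c c'"
  shows "(transition c c' has_derivative transition_deriv c c' x) (at x)"
  using smooth_on_differentiable[OF transition_smooth[OF assms(1,2)] assms(3)]
  by (simp only: frechet_derivative_works)

lemma linear_transition_deriv:
  assumes "c \<in> A" "c' \<in> A" "x \<in> overlap c c'"
  shows "linear (transition_deriv c c' x)"
  by (rule has_derivative_linear[OF transition_derivative[OF assms]])

lemma dir_deriv_transition:
  assumes "c \<in> A" "c' \<in> A" "x \<in> overlap c c'" "f differentiable (at (transition c c' x))"
  shows "((\<lambda>y. f (transition c c' y)) has_derivative
    (\<lambda>v. dir_deriv f (transition_deriv c c' x v) (transition c c' x))) (at x)"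
  by (rule has_derivative_compose[OF transition_derivative[OF assms(1-3)] dir_deriv_works[OF assms(4)]])

lemma transition_deriv_differentiable:
  assumes "c \<in> A" "c' \<in> A" "x \<in> overlap c c'"
  shows "(\<lambda>y. transition_deriv c c' y v) differentiable (at x)"
  by (rule smooth_on_differentiable[OF smooth_on_dir_deriv[OF transition_smooth[OF assms(1,2)]] assms(3)])

text \<open>
  Second derivatives of real functions are symmetric; this applies to every coordinate of the
  transition map.
\<close>

lemma transition_deriv_symmetric:
  assumes "c \<in> A" "c' \<in> A" "x \<in> overlap c c'"
  shows "dir_deriv (\<lambda>y. transition_deriv c c' y v) w x = dir_deriv (\<lambda>y. transition_deriv c c' y w) v x"
proof (rule euclidean_eqI)
  fix b :: 'e
  let ?T = "transition c c'" and ?S = "overlap c c'"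
  have S: "open ?S" by (rule open_overlap[OF is_chart[OF assms(1)] is_chart[OF assms(2)]])
  have smooth: "smooth_on ?S (\<lambda>y. ?T y \<bullet> b)"
    by (rule smooth_on_linear[OF S bounded_linear_inner_left transition_smooth[OF assms(1,2)]])
  have 1: "dir_deriv (\<lambda>y. ?T y \<bullet> b) v y = transition_deriv c c' y v \<bullet> b" if "y \<in> ?S" for y v
    by (rule dir_deriv_eqI, rule has_derivative_inner_left, rule transition_derivative[OF assms(1,2) that])
  have 2: "dir_deriv (\<lambda>y. dir_deriv (\<lambda>y. ?T y \<bullet> b) v y) w x
      = dir_deriv (\<lambda>y. transition_deriv c c' y v) w x \<bullet> b" for v w
    by (subst dir_deriv_cong[OF S assms(3) 1], assumption, rule dir_deriv_eqI,
        rule has_derivative_inner_left, rule dir_deriv_works, rule transition_deriv_differentiable[OF assms])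
  show "dir_deriv (\<lambda>y. transition_deriv c c' y v) w x \<bullet> b
      = dir_deriv (\<lambda>y. transition_deriv c c' y w) v x \<bullet> b"
    using symmetric_second_derivative[OF S assms(3) smooth, of v w] unfolding 2 .
qed

text \<open>
  The transformation rule for the local representatives, with the points of the manifold replaced by their
  images in the chart, where the representatives are differentiated.
\<close>

lemma diff_form_iff:
  "diff_form A k \<omega> \<longleftrightarrow>
     (\<forall>c x. c \<notin> A \<or> x \<notin> chart_ran c \<longrightarrow> \<omega> c x = (\<lambda>_. 0)) \<and>
     (\<forall>c\<in>A. \<forall>x\<in>chart_ran c. alternating_form k (\<omega> c x)) \<and>
     (\<forall>c\<in>A. \<forall>vs. length vs = k \<longrightarrow> smooth_on (chart_ran c) (\<lambda>x. \<omega> c x vs)) \<and>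
     (\<forall>c\<in>A. \<forall>c'\<in>A. \<forall>x\<in>overlap c c'. \<forall>vs. length vs = k \<longrightarrow>
        \<omega> c x vs = \<omega> c' (transition c c' x) (map (transition_deriv c c' x) vs))"
proof -
  have "transition c c' (chart_map c p) = chart_map c' p" if "c \<in> A" "p \<in> chart_dom c" for c c' p
    using that by (simp add: transition_def chart_inv_chart_map is_chart)
  then show ?thesis
    unfolding diff_form_def overlap_def by (auto 0 4)
qed

lemma form_outside: "diff_form A k \<omega> \<Longrightarrow> c \<notin> A \<or> x \<notin> chart_ran c \<Longrightarrow> \<omega> c x = (\<lambda>_. 0)"
  unfolding diff_form_iff by blast

lemma form_alternating: "diff_form A k \<omega> \<Longrightarrow> alternating_form k (\<omega> c x)"
proof (cases "c \<in> A \<and> x \<in> chart_ran c")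
  case False
  assume "diff_form A k \<omega>"
  then have "\<omega> c x = (\<lambda>_. 0)" using False form_outside by blast
  then show ?thesis by (simp add: alternating_form_def linear_iff)
qed (simp add: diff_form_iff)

lemma form_length: "diff_form A k \<omega> \<Longrightarrow> length vs \<noteq> k \<Longrightarrow> \<omega> c x vs = 0"
  by (rule alternating_form_length[OF form_alternating])

lemma form_smooth: "diff_form A k \<omega> \<Longrightarrow> c \<in> A \<Longrightarrow> smooth_on (chart_ran c) (\<lambda>x. \<omega> c x vs)"
proof (cases "length vs = k")
  case False
  assume "diff_form A k \<omega>"
  then show ?thesis using form_length[OF _ False, of \<omega>] by (simp add: smooth_on_const)
qed (simp add: diff_form_iff)

lemma form_transition:
  "diff_form A k \<omega> \<Longrightarrow> c \<in> A \<Longrightarrow> c' \<in> A \<Longrightarrow> x \<in> overlap c c' \<Longrightarrow> length vs = k \<Longrightarrow>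
    \<omega> c x vs = \<omega> c' (transition c c' x) (map (transition_deriv c c' x) vs)"
  by (simp add: diff_form_iff)

lemma form_differentiable:
  "diff_form A k \<omega> \<Longrightarrow> c \<in> A \<Longrightarrow> x \<in> chart_ran c \<Longrightarrow> (\<lambda>y. \<omega> c y vs) differentiable (at x)"
  by (rule smooth_on_differentiable[OF form_smooth])

lemma form_linear_1: "diff_form A 1 \<omega> \<Longrightarrow> linear (\<lambda>v. \<omega> c x [v])"
  using form_alternating[of 1 \<omega> c x] by (simp only: alternating_form_1_iff)

lemma diff_form_diff:
  assumes "diff_form A k \<omega>" "diff_form A k \<eta>"
  shows "diff_form A k (\<lambda>c x vs. \<omega> c x vs - \<eta> c x vs)"
  unfolding diff_form_iff
proof (intro conjI ballI allI impI)
  show "alternating_form k (\<lambda>vs. \<omega> c x vs - \<eta> c x vs)" for c x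
    using form_alternating[OF assms(1), of c x] form_alternating[OF assms(2), of c x]
    by (auto simp: alternating_form_def intro!: linear_compose_sub)
  show "smooth_on (chart_ran c) (\<lambda>x. \<omega> c x vs - \<eta> c x vs)" if "c \<in> A" for c vs
    by (intro smooth_on_diff form_smooth[OF assms(1)] form_smooth[OF assms(2)] chart_ran_open is_chart that)
qed (use assms in \<open>simp_all add: form_outside form_transition[symmetric]\<close>)

lemma diff_form_zero: "diff_form A k zero_form"
  by (auto simp: diff_form_iff zero_form_def alternating_form_def linear_iff smooth_on_const)

lemma diff_form_wedge:
  assumes "diff_form A k \<omega>" "diff_form A l \<eta>"
  shows "diff_form A (k + l) (wedge k l \<omega> \<eta>)"
  unfolding diff_form_iff
proof (intro conjI ballI allI impI)
  show "wedge k l \<omega> \<eta> c x = (\<lambda>_. 0)" if "c \<notin> A \<or> x \<notin> chart_ran c" for c x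
    using form_outside[OF assms(1) that] by (simp add: wedge_def fun_eq_iff)
  show "alternating_form (k + l) (wedge k l \<omega> \<eta> c x)" for c x
    unfolding wedge_eq_wedge_at
    by (rule alternating_form_wedge_at[OF form_alternating[OF assms(1)] form_alternating[OF assms(2)]])
  show "smooth_on (chart_ran c) (\<lambda>x. wedge k l \<omega> \<eta> c x vs)" if "c \<in> A" "length vs = k + l" for c vs
  proof -
    have S: "open (chart_ran c)" using chart_ran_open is_chart that by blast
    show ?thesis unfolding wedge_def
      using that by (auto simp: divide_inverse intro!: smooth_on_mult[OF S] smooth_on_sum[OF S]
          smooth_on_const form_smooth[OF assms(1)] form_smooth[OF assms(2)])
  qed
  show "wedge k l \<omega> \<eta> c x vs = wedge k l \<omega> \<eta> c' (transition c c' x) (map (transition_deriv c c' x) vs)"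
    if c: "c \<in> A" "c' \<in> A" "x \<in> overlap c c'" and len: "length vs = k + l" for c c' x vs
  proof -
    have "map (\<lambda>i. map (transition_deriv c c' x) vs ! \<sigma> i) [a..<b]
        = map (transition_deriv c c' x) (map (\<lambda>i. vs ! \<sigma> i) [a..<b])"
      if "\<sigma> permutes {..<k + l}" "b \<le> k + l" for \<sigma> a b
      using permutes_in_image[OF that(1)] that(2) len by auto
    then show ?thesis
      using len by (auto simp: wedge_def form_transition[OF assms(1) c] form_transition[OF assms(2) c]
          simp del: map_map intro!: sum.cong)
  qed
qed

lemma ext_d_0: "x \<in> chart_ran c \<Longrightarrow> ext_d 0 \<omega> c x [v] = dir_deriv (\<lambda>y. \<omega> c y []) v x"
  by (simp add: ext_d_def)

lemma ext_d_1: "x \<in> chart_ran c \<Longrightarrow>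
    ext_d 1 \<omega> c x [v, w] = dir_deriv (\<lambda>y. \<omega> c y [w]) v x - dir_deriv (\<lambda>y. \<omega> c y [v]) w x"
  by (simp add: ext_d_def)

lemma ext_d_2: "x \<in> chart_ran c \<Longrightarrow>
    ext_d 2 \<omega> c x [u, v, w] = dir_deriv (\<lambda>y. \<omega> c y [v, w]) u x
      - dir_deriv (\<lambda>y. \<omega> c y [u, w]) v x + dir_deriv (\<lambda>y. \<omega> c y [u, v]) w x"
  by (simp add: ext_d_def numeral_2_eq_2)

lemma ext_d_3: "x \<in> chart_ran c \<Longrightarrow>
    ext_d 3 \<omega> c x [u, v, w, z] = dir_deriv (\<lambda>y. \<omega> c y [v, w, z]) u x
      - dir_deriv (\<lambda>y. \<omega> c y [u, w, z]) v x + dir_deriv (\<lambda>y. \<omega> c y [u, v, z]) w x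
      - dir_deriv (\<lambda>y. \<omega> c y [u, v, w]) z x"
  by (simp add: ext_d_def numeral_3_eq_3)

text \<open>
  Outside of the atlas a form is constantly 0, and the derivatives in the definition of \<open>ext_d\<close> vanish with it.
\<close>

lemma ext_d_outside:
  assumes "diff_form A k \<omega>" "c \<notin> A \<or> x \<notin> chart_ran c"
  shows "ext_d k \<omega> c x = (\<lambda>_. 0)"
proof (cases "c \<in> A")
  case False
  then have "(\<lambda>y. \<omega> c y vs) = (\<lambda>y. 0)" for vs using form_outside[OF assms(1)] by simp
  then show ?thesis by (simp add: ext_d_def fun_eq_iff)
qed (use assms in \<open>simp add: ext_d_def fun_eq_iff\<close>)

lemma dir_deriv_linear: "f differentiable (at x) \<Longrightarrow> linear (\<lambda>v. dir_deriv f v x)"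
  by (rule linear_frechet_derivative)

lemma diff_form_ext_d_0:
  assumes \<omega>: "diff_form A 0 \<omega>"
  shows "diff_form A 1 (ext_d 0 \<omega>)"
  unfolding diff_form_iff
proof (intro conjI ballI allI impI)
  show "ext_d 0 \<omega> c x = (\<lambda>_. 0)" if "c \<notin> A \<or> x \<notin> chart_ran c" for c x
    by (rule ext_d_outside[OF \<omega> that])
  show "alternating_form 1 (ext_d 0 \<omega> c x)" if "c \<in> A" "x \<in> chart_ran c" for c x
    unfolding alternating_form_1_iff
    using that dir_deriv_linear[OF form_differentiable[OF \<omega> that]] by (auto simp: ext_d_0 ext_d_def)
  show "smooth_on (chart_ran c) (\<lambda>x. ext_d 0 \<omega> c x vs)" if c: "c \<in> A" and len: "length vs = 1" for c vs
  proof -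
    obtain v where vs: "vs = [v]" using len by (cases vs) auto
    show ?thesis
      by (rule smooth_on_cong[OF chart_ran_open[OF is_chart[OF c]] _
            smooth_on_dir_deriv[OF form_smooth[OF \<omega> c]]]) (simp add: vs ext_d_0)
  qed
  show "ext_d 0 \<omega> c x vs = ext_d 0 \<omega> c' (transition c c' x) (map (transition_deriv c c' x) vs)"
    if c: "c \<in> A" "c' \<in> A" "x \<in> overlap c c'" and len: "length vs = 1" for c c' x vs
  proof -
    obtain v where vs: "vs = [v]" using len by (cases vs) auto
    have x: "x \<in> chart_ran c" "transition c c' x \<in> chart_ran c'"
      using overlap_in_ran[OF c(3)] transition_in_ran[OF c(1,3)] by auto
    have S: "open (overlap c c')" by (rule open_overlap[OF is_chart[OF c(1)] is_chart[OF c(2)]])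
    have "dir_deriv (\<lambda>y. \<omega> c y []) v x = dir_deriv (\<lambda>y. \<omega> c' (transition c c' y) []) v x"
      by (rule dir_deriv_cong[OF S c(3)]) (use form_transition[OF \<omega> c(1,2), of _ "[]"] in simp)
    also have "\<dots> = dir_deriv (\<lambda>y. \<omega> c' y []) (transition_deriv c c' x v) (transition c c' x)"
      by (rule dir_deriv_eqI, rule dir_deriv_transition[OF c, where f = "\<lambda>y. \<omega> c' y []"])
        (rule form_differentiable[OF \<omega> c(2) x(2)])
    finally show ?thesis using x by (simp add: vs ext_d_0)
  qed
qed

text \<open>
  The transformation rule for \<open>d\<omega>\<close> holds because the terms with second derivatives of the transition map, which
  arise from differentiating the transformation rule for \<open>\<omega>\<close>, are symmetric and cancel.
\<close>

lemma diff_form_ext_d_1: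
  assumes \<omega>: "diff_form A 1 \<omega>"
  shows "diff_form A 2 (ext_d 1 \<omega>)"
  unfolding diff_form_iff
proof (intro conjI ballI allI impI)
  have two: "\<exists>v w. vs = [v, w]" if "length vs = 2" for vs :: "'e list"
    using that by (cases vs; cases "tl vs") auto
  show "ext_d 1 \<omega> c x = (\<lambda>_. 0)" if "c \<notin> A \<or> x \<notin> chart_ran c" for c x
    by (rule ext_d_outside[OF \<omega> that])
  show "alternating_form 2 (ext_d 1 \<omega> c x)" if c: "c \<in> A" "x \<in> chart_ran c" for c x
    unfolding alternating_form_def
  proof (intro conjI allI impI)
    show "ext_d 1 \<omega> c x vs = 0" if "length vs \<noteq> 2" for vs
      using that by (simp add: ext_d_def)
    have l1: "linear (\<lambda>v. dir_deriv (\<lambda>y. \<omega> c y [w]) v x)" for w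
      by (rule dir_deriv_linear[OF form_differentiable[OF \<omega> c]])
    have l2: "linear (\<lambda>w. dir_deriv (\<lambda>y. \<omega> c y [w]) v x)" for v
    proof (rule linearI)
      fix a b :: 'e and r :: real
      have "(\<lambda>y. \<omega> c y [a + b]) = (\<lambda>y. \<omega> c y [a] + \<omega> c y [b])"
        "(\<lambda>y. \<omega> c y [r *\<^sub>R a]) = (\<lambda>y. r * \<omega> c y [a])"
        using form_linear_1[OF \<omega>] by (auto simp: fun_eq_iff linear_iff)
      moreover have "((\<lambda>y. \<omega> c y [a] + \<omega> c y [b]) has_derivative
          (\<lambda>v. dir_deriv (\<lambda>y. \<omega> c y [a]) v x + dir_deriv (\<lambda>y. \<omega> c y [b]) v x)) (at x)"
        "((\<lambda>y. r * \<omega> c y [a]) has_derivative (\<lambda>v. r * dir_deriv (\<lambda>y. \<omega> c y [a]) v x)) (at x)"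
        by (intro has_derivative_add has_derivative_mult_right dir_deriv_works form_differentiable[OF \<omega> c])+
      ultimately show "dir_deriv (\<lambda>y. \<omega> c y [a + b]) v x =
          dir_deriv (\<lambda>y. \<omega> c y [a]) v x + dir_deriv (\<lambda>y. \<omega> c y [b]) v x"
        "dir_deriv (\<lambda>y. \<omega> c y [r *\<^sub>R a]) v x = r *\<^sub>R dir_deriv (\<lambda>y. \<omega> c y [a]) v x"
        by (simp_all add: dir_deriv_eqI)
    qed
    show "linear (\<lambda>v. ext_d 1 \<omega> c x (vs[i := v]))" if i: "length vs = 2 \<and> i < 2" for vs i
    proof -
      obtain a b where vs: "vs = [a, b]" using two i by blast
      have "linear (\<lambda>v. dir_deriv (\<lambda>y. \<omega> c y [b]) v x - dir_deriv (\<lambda>y. \<omega> c y [v]) b x)"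
        "linear (\<lambda>v. dir_deriv (\<lambda>y. \<omega> c y [v]) a x - dir_deriv (\<lambda>y. \<omega> c y [a]) v x)"
        by (intro linear_compose_sub l1 l2)+
      moreover have "i = 0 \<or> i = 1" using that by auto
      ultimately show ?thesis using c(2) by (auto simp: vs ext_d_1[unfolded One_nat_def])
    qed
    show "ext_d 1 \<omega> c x vs = 0" if i: "length vs = 2 \<and> i < j \<and> j < 2 \<and> vs ! i = vs ! j" for vs i j
    proof -
      obtain a b where vs: "vs = [a, b]" using two i by blast
      have ij: "i = 0" "j = 1" using i by auto
      then have "a = b" using i by (simp add: vs ij)
      then show ?thesis using c(2) by (simp add: vs ext_d_1[unfolded One_nat_def])
    qed
  qed
  show "smooth_on (chart_ran c) (\<lambda>x. ext_d 1 \<omega> c x vs)" if c: "c \<in> A" and len: "length vs = 2" for c vs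
  proof -
    obtain v w where vs: "vs = [v, w]" using len two by blast
    have S: "open (chart_ran c)" using c chart_ran_open is_chart by blast
    show ?thesis
      by (rule smooth_on_cong[OF S _ smooth_on_diff[OF S smooth_on_dir_deriv[OF form_smooth[OF \<omega> c], of "[w]" v]
          smooth_on_dir_deriv[OF form_smooth[OF \<omega> c], of "[v]" w]]]) (simp only: vs ext_d_1)
  qed
  show "ext_d 1 \<omega> c x vs = ext_d 1 \<omega> c' (transition c c' x) (map (transition_deriv c c' x) vs)"
    if c: "c \<in> A" "c' \<in> A" "x \<in> overlap c c'" and len: "length vs = 2" for c c' x vs
  proof -
    obtain v w where vs: "vs = [v, w]" using len two by blast
    let ?T = "transition c c'"
    let ?D = "transition_deriv c c'"
    have x: "x \<in> chart_ran c" "?T x \<in> chart_ran c'"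
      using overlap_in_ran[OF c(3)] transition_in_ran[OF c(1,3)] by auto
    have S: "open (overlap c c')" by (rule open_overlap[OF is_chart[OF c(1)] is_chart[OF c(2)]])
    have key: "dir_deriv (\<lambda>y. \<omega> c y [w]) v x =
        dir_deriv (\<lambda>z. \<omega> c' z [?D x w]) (?D x v) (?T x) + \<omega> c' (?T x) [dir_deriv (\<lambda>y. ?D y w) v x]"
      for v w
    proof -
      \<comment> \<open>The point and the vector in \<open>\<omega> c' (?T y) [?D y w]\<close> both vary with \<open>y\<close>. Written in a basis, this is a
        sum of products, to which the product rule applies.\<close>
      have expand: "\<omega> c' z [u] = (\<Sum>b\<in>Basis. (u \<bullet> b) * \<omega> c' z [b])" for z u
      proof -
        have "\<omega> c' z [\<Sum>b\<in>Basis. (u \<bullet> b) *\<^sub>R b] = (\<Sum>b\<in>Basis. \<omega> c' z [(u \<bullet> b) *\<^sub>R b])"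
          using linear_sum[OF form_linear_1[OF \<omega>]] by (simp add: o_def)
        then show ?thesis
          using linear_scale[OF form_linear_1[OF \<omega>]] by (simp add: euclidean_representation)
      qed
      have "dir_deriv (\<lambda>y. \<omega> c y [w]) v x = dir_deriv (\<lambda>y. \<Sum>b\<in>Basis. (?D y w \<bullet> b) * \<omega> c' (?T y) [b]) v x"
        by (rule dir_deriv_cong[OF S c(3)])
          (use form_transition[OF \<omega> c(1,2), of _ "[w]"] in \<open>simp add: expand[symmetric]\<close>)
      also have "\<dots> = (\<Sum>b\<in>Basis. (?D x w \<bullet> b) * dir_deriv (\<lambda>z. \<omega> c' z [b]) (?D x v) (?T x)
          + (dir_deriv (\<lambda>y. ?D y w) v x \<bullet> b) * \<omega> c' (?T x) [b])"
        by (rule dir_deriv_eqI, intro has_derivative_sum has_derivative_mult has_derivative_inner_left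
            dir_deriv_works transition_deriv_differentiable[OF c]
            dir_deriv_transition[OF c, where f = "\<lambda>z. \<omega> c' z [b]" for b]
            form_differentiable[OF \<omega> c(2) x(2)])
      also have "\<dots> = (\<Sum>b\<in>Basis. (?D x w \<bullet> b) * dir_deriv (\<lambda>z. \<omega> c' z [b]) (?D x v) (?T x))
          + \<omega> c' (?T x) [dir_deriv (\<lambda>y. ?D y w) v x]"
        by (simp add: sum.distrib expand[symmetric])
      also have "(\<Sum>b\<in>Basis. (?D x w \<bullet> b) * dir_deriv (\<lambda>z. \<omega> c' z [b]) (?D x v) (?T x))
          = dir_deriv (\<lambda>z. \<Sum>b\<in>Basis. (?D x w \<bullet> b) * \<omega> c' z [b]) (?D x v) (?T x)"
        by (rule sym, rule dir_deriv_eqI, intro has_derivative_sum has_derivative_mult_right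
            dir_deriv_works form_differentiable[OF \<omega> c(2) x(2)])
      finally show ?thesis by (simp only: expand[symmetric])
    qed
    show ?thesis
      unfolding vs list.map ext_d_1[OF x(1)] ext_d_1[OF x(2)] key
      using transition_deriv_symmetric[OF c, of v w] by simp
  qed
qed

lemma ext_d_diff:
  assumes "diff_form A k \<omega>" "diff_form A k \<eta>"
  shows "ext_d k (\<lambda>c x vs. \<omega> c x vs - \<eta> c x vs) = (\<lambda>c x vs. ext_d k \<omega> c x vs - ext_d k \<eta> c x vs)"
proof (intro ext)
  fix c x vs
  show "ext_d k (\<lambda>c x vs. \<omega> c x vs - \<eta> c x vs) c x vs = ext_d k \<omega> c x vs - ext_d k \<eta> c x vs"
  proof (cases "c \<in> A \<and> x \<in> chart_ran c")
    case True
    then have c: "c \<in> A" "x \<in> chart_ran c" by auto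
    have "dir_deriv (\<lambda>y. \<omega> c y ws - \<eta> c y ws) v x =
        dir_deriv (\<lambda>y. \<omega> c y ws) v x - dir_deriv (\<lambda>y. \<eta> c y ws) v x" for ws v
      by (rule dir_deriv_eqI, intro has_derivative_diff dir_deriv_works
          form_differentiable[OF assms(1) c] form_differentiable[OF assms(2) c])
    then show ?thesis by (simp add: ext_d_def right_diff_distrib sum_subtractf)
  next
    case False
    then show ?thesis
      using ext_d_outside[OF assms(1), of c x] ext_d_outside[OF assms(2), of c x]
        ext_d_outside[OF diff_form_diff[OF assms], of c x] by simp
  qed
qed

end

section \<open>Exactness and cohomology classes\<close>

context smooth_atlas
begin

text \<open>
  The double sum runs over the second derivatives in the directions of two of the arguments, each of them
  occurring twice. The pairs \<open>(i, j)\<close> with \<open>i \<le> j\<close> and \<open>(Suc j, i)\<close> remove the same two arguments in opposite order;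
  by symmetry of the second derivatives their terms differ only in sign.
\<close>

lemma ext_d_ext_d:
  assumes \<omega>: "diff_form A k \<omega>"
  shows "ext_d (Suc k) (ext_d k \<omega>) = zero_form"
proof (intro ext)
  fix c x and vs :: "'e list"
  show "ext_d (Suc k) (ext_d k \<omega>) c x vs = zero_form c x vs"
  proof (cases "c \<in> A \<and> x \<in> chart_ran c \<and> length vs = Suc (Suc k)")
    case False
    have "ext_d k \<omega> c y = (\<lambda>_. 0)" if "c \<notin> A" for y
      using ext_d_outside[OF \<omega>] that by blast
    with False show ?thesis
      by (auto simp: ext_d_def[of "Suc k"] zero_form_def)
  next
    case True
    then have c: "c \<in> A" and x: "x \<in> chart_ran c" and len: "length vs = Suc (Suc k)" by auto
    have R: "open (chart_ran c)" by (rule chart_ran_open[OF is_chart[OF c]])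
    \<comment> \<open>The list without its entry at position \<open>i\<close>.\<close>
    define rm where "rm i ws = take i ws @ drop (Suc i) ws" for i :: nat and ws :: "'e list"
    have rm_nth: "i < length ws \<Longrightarrow> j < length ws - 1 \<Longrightarrow> rm i ws ! j = ws ! (if j < i then j else Suc j)"
      for i j ws by (auto simp: rm_def nth_append min_def)
    have rm_len: "i < length ws \<Longrightarrow> length (rm i ws) = length ws - 1" for i ws
      by (auto simp: rm_def)
    have rm_rm: "rm i (rm (Suc j) vs) = rm j (rm i vs)" if "i \<le> j" "j \<le> k" for i j
      by (rule nth_equalityI) (use that len in \<open>auto simp: rm_nth rm_len\<close>)
    let ?D = "\<lambda>ws v y. dir_deriv (\<lambda>y. \<omega> c y ws) v y"
    let ?D2 = "\<lambda>ws v w. dir_deriv (\<lambda>y. dir_deriv (\<lambda>y. \<omega> c y ws) v y) w x"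
    have sym: "?D2 ws v w = ?D2 ws w v" for ws v w
      by (rule symmetric_second_derivative[OF R x form_smooth[OF \<omega> c]])
    have diff: "(\<lambda>y. ?D ws v y) differentiable (at x)" for ws v
      by (rule smooth_on_differentiable[OF smooth_on_dir_deriv[OF form_smooth[OF \<omega> c]] x])
    define H where "H = (\<lambda>(i, j). (-1) ^ (i + j) * ?D2 (rm j (rm i vs)) (rm i vs ! j) (vs ! i))"
    have inner: "dir_deriv (\<lambda>y. ext_d k \<omega> c y (rm i vs)) (vs ! i) x
        = (\<Sum>j\<le>k. (-1) ^ j * ?D2 (rm j (rm i vs)) (rm i vs ! j) (vs ! i))" if "i \<le> Suc k" for i
    proof -
      have "dir_deriv (\<lambda>y. ext_d k \<omega> c y (rm i vs)) (vs ! i) x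
          = dir_deriv (\<lambda>y. \<Sum>j\<le>k. (-1) ^ j * ?D (rm j (rm i vs)) (rm i vs ! j) y) (vs ! i) x"
        by (rule dir_deriv_cong[OF R x]) (use that len in \<open>simp add: ext_d_def rm_len rm_def[symmetric]\<close>)
      also have "\<dots> = (\<Sum>j\<le>k. (-1) ^ j * ?D2 (rm j (rm i vs)) (rm i vs ! j) (vs ! i))"
        by (rule dir_deriv_eqI, intro has_derivative_sum has_derivative_mult_right dir_deriv_works diff)
      finally show ?thesis .
    qed
    have "ext_d (Suc k) (ext_d k \<omega>) c x vs = (\<Sum>i\<le>Suc k. \<Sum>j\<le>k. H (i, j))"
    proof -
      have "ext_d (Suc k) (ext_d k \<omega>) c x vs
          = (\<Sum>i\<le>Suc k. (-1) ^ i * dir_deriv (\<lambda>y. ext_d k \<omega> c y (rm i vs)) (vs ! i) x)"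
        unfolding ext_d_def[of "Suc k"] rm_def using x len by simp
      also have "\<dots> = (\<Sum>i\<le>Suc k. \<Sum>j\<le>k. H (i, j))"
        by (intro sum.cong refl) (simp add: inner H_def sum_distrib_left power_add mult.assoc)
      finally show ?thesis .
    qed
    also have "\<dots> = sum H ({..Suc k} \<times> {..k})"
      by (simp add: sum.cartesian_product)
    also have "{..Suc k} \<times> {..k} = {(i, j). i \<le> j \<and> j \<le> k} \<union> {(i, j). j < i \<and> i \<le> Suc k}"
      by auto
    also have "sum H \<dots> = sum H {(i, j). i \<le> j \<and> j \<le> k} + sum H {(i, j). j < i \<and> i \<le> Suc k}"
    proof (rule sum.union_disjoint)
      show "finite {(i, j). i \<le> j \<and> j \<le> k}"
        by (rule finite_subset[of _ "{..k} \<times> {..k}"]) auto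
      show "finite {(i, j). j < i \<and> i \<le> Suc k}"
        by (rule finite_subset[of _ "{..Suc k} \<times> {..Suc k}"]) auto
    qed auto
    \<comment> \<open>Removing entry \<open>Suc j\<close> first leaves entry \<open>i \<le> j\<close> in place, while removing entry \<open>i\<close> first shifts
      entry \<open>Suc j\<close> to position \<open>j\<close>.\<close>
    also have "sum H {(i, j). j < i \<and> i \<le> Suc k} = (\<Sum>(i, j) | i \<le> j \<and> j \<le> k. H (Suc j, i))"
    proof (rule sum.reindex_bij_witness[where i = "\<lambda>(i, j). (Suc j, i)" and j = "\<lambda>(i, j). (j, i - 1)"])
    qed auto
    also have "\<dots> = (\<Sum>(i, j) | i \<le> j \<and> j \<le> k. - H (i, j))"
    proof (rule sum.cong[OF refl], clarify)
      fix i j assume ij: "i \<le> j" "j \<le> k"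
      have "rm (Suc j) vs ! i = vs ! i" "rm i vs ! j = vs ! Suc j"
        using ij len by (simp_all add: rm_nth)
      then show "H (Suc j, i) = - H (i, j)"
        using sym[of "rm j (rm i vs)" "vs ! i" "vs ! Suc j"]
        by (simp add: H_def rm_rm[OF ij] add.commute)
    qed
    also have "sum H {(i, j). i \<le> j \<and> j \<le> k} + \<dots> = 0"
      by (simp add: sum_negf split_def)
    finally show ?thesis by (simp add: zero_form_def)
  qed
qed

lemma closed_zero_form: "closed_form A k zero_form"
proof -
  have "ext_d k zero_form = zero_form" by (simp add: ext_d_def zero_form_def fun_eq_iff)
  then show ?thesis by (simp add: closed_form_def diff_form_zero)
qed

lemma exact_form_Suc_diff:
  assumes "exact_form A (Suc j) \<omega>" "exact_form A (Suc j) \<eta>"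
  shows "exact_form A (Suc j) (\<lambda>c x vs. \<omega> c x vs - \<eta> c x vs)"
proof -
  obtain \<theta> \<xi> where "diff_form A j \<theta>" "\<omega> = ext_d j \<theta>" "diff_form A j \<xi>" "\<eta> = ext_d j \<xi>"
    using assms by (auto simp: exact_form_def)
  then show ?thesis
    unfolding exact_form_def nat.case
    by (intro exI[of _ "\<lambda>c x vs. \<theta> c x vs - \<xi> c x vs"]) (simp add: diff_form_diff ext_d_diff)
qed

lemma exact_form_zero: "exact_form A (Suc j) zero_form"
proof -
  have "ext_d j zero_form = zero_form" by (simp add: ext_d_def zero_form_def fun_eq_iff)
  then show ?thesis unfolding exact_form_def nat.case using diff_form_zero by metis
qed

text \<open>
  Classes are sets of forms, so equality with the zero class means that \<open>\<omega>\<close> and 0 are cohomologous to the same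
  forms \<open>\<eta>\<close>. The differences \<open>\<omega> - \<eta>\<close> and \<open>0 - \<eta>\<close> differ by the exact form \<open>\<omega>\<close>.
\<close>

lemma exact_imp_de_Rham_zero:
  assumes cl: "closed_form A (Suc j) \<omega>" and ex: "exact_form A (Suc j) \<omega>"
  shows "de_Rham_class A (Suc j) \<omega> \<in> de_Rham A (Suc j)"
    and "de_Rham_class A (Suc j) \<omega> = de_Rham_zero A (Suc j)"
proof -
  show "de_Rham_class A (Suc j) \<omega> \<in> de_Rham A (Suc j)"
    unfolding de_Rham_class_def de_Rham_def by (rule quotientI) (use cl in simp)
  have iff: "exact_form A (Suc j) (\<lambda>c x vs. \<omega> c x vs - \<eta> c x vs) \<longleftrightarrow>
      exact_form A (Suc j) (\<lambda>c x vs. zero_form c x vs - \<eta> c x vs)" for \<eta>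
  proof
    assume "exact_form A (Suc j) (\<lambda>c x vs. \<omega> c x vs - \<eta> c x vs)"
    from exact_form_Suc_diff[OF this ex]
    show "exact_form A (Suc j) (\<lambda>c x vs. zero_form c x vs - \<eta> c x vs)" by (simp add: zero_form_def)
  next
    assume "exact_form A (Suc j) (\<lambda>c x vs. zero_form c x vs - \<eta> c x vs)"
    from exact_form_Suc_diff[OF ex exact_form_Suc_diff[OF exact_form_zero this]]
    show "exact_form A (Suc j) (\<lambda>c x vs. \<omega> c x vs - \<eta> c x vs)" by (simp add: zero_form_def)
  qed
  have "(\<omega>, \<eta>) \<in> cohomologous A (Suc j) \<longleftrightarrow> (zero_form, \<eta>) \<in> cohomologous A (Suc j)" for \<eta>
    by (simp only: cohomologous_def mem_Collect_eq prod.case iff cl closed_zero_form)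
  then show "de_Rham_class A (Suc j) \<omega> = de_Rham_zero A (Suc j)"
    by (simp only: de_Rham_zero_def de_Rham_class_def Image_singleton)
qed

section \<open>Functions as forms of degree zero\<close>

lemma diff_form_0I:
  assumes "\<And>c. c \<in> A \<Longrightarrow> smooth_on (chart_ran c) (h c)"
    and "\<And>c c' x. c \<in> A \<Longrightarrow> c' \<in> A \<Longrightarrow> x \<in> overlap c c' \<Longrightarrow> h c x = h c' (transition c c' x)"
  shows "diff_form A 0 (\<lambda>c x vs. if c \<in> A \<and> x \<in> chart_ran c \<and> vs = [] then h c x else 0)"
  unfolding diff_form_iff
proof (intro conjI ballI allI impI)
  show "smooth_on (chart_ran c) (\<lambda>x. if c \<in> A \<and> x \<in> chart_ran c \<and> vs = [] then h c x else 0)"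
    if "c \<in> A" "length vs = 0" for c and vs :: "'e list"
    by (rule smooth_on_cong[OF chart_ran_open[OF is_chart[OF that(1)]] _ assms(1)[OF that(1)]])
      (use that in auto)
  fix c c' x and vs :: "'e list" assume c: "c \<in> A" "c' \<in> A" "x \<in> overlap c c'" "length vs = 0"
  show "(if c \<in> A \<and> x \<in> chart_ran c \<and> vs = [] then h c x else 0) =
    (if c' \<in> A \<and> transition c c' x \<in> chart_ran c' \<and> map (transition_deriv c c' x) vs = []
      then h c' (transition c c' x) else 0)"
    using assms(2)[OF c(1-3)] overlap_in_ran[OF c(3)] transition_in_ran[OF c(1,3)] c by simp
qed (auto simp: alternating_form_def)

text \<open>
  Where \<open>\<alpha>\<close> does not vanish on a constant vector \<open>v\<close>, the factor is the quotient \<open>\<rho>(v) / \<alpha>(v)\<close>, hence smooth. It is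
  determined by its defining property, which both forms carry along transition maps, so that the
  values in different charts fit together.
\<close>

lemma proportional_forms:
  assumes \<rho>: "diff_form A 1 \<rho>" and \<alpha>: "diff_form A 1 \<alpha>"
    and nz: "\<And>c x. c \<in> A \<Longrightarrow> x \<in> chart_ran c \<Longrightarrow> \<exists>v. \<alpha> c x [v] \<noteq> 0"
    and factor: "\<And>c x. c \<in> A \<Longrightarrow> x \<in> chart_ran c \<Longrightarrow> \<exists>m. \<forall>v. \<rho> c x [v] = m * \<alpha> c x [v]"
  shows "\<exists>\<mu>. diff_form A 0 \<mu> \<and>
    (\<forall>c\<in>A. \<forall>x\<in>chart_ran c. \<forall>v. \<rho> c x [v] = \<mu> c x [] * \<alpha> c x [v])"
proof -
  obtain m where m: "\<And>c x v. c \<in> A \<Longrightarrow> x \<in> chart_ran c \<Longrightarrow> \<rho> c x [v] = m c x * \<alpha> c x [v]"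
    using factor by metis
  define \<mu> where "\<mu> = (\<lambda>c x (vs :: 'e list). if c \<in> A \<and> x \<in> chart_ran c \<and> vs = [] then m c x else 0)"
  have "diff_form A 0 \<mu>"
    unfolding \<mu>_def
  proof (rule diff_form_0I)
    fix c assume c: "c \<in> A"
    have R: "open (chart_ran c)" by (rule chart_ran_open[OF is_chart[OF c]])
    show "smooth_on (chart_ran c) (m c)"
    proof (rule smooth_on_locally)
      fix x assume x: "x \<in> chart_ran c"
      obtain v where v: "\<alpha> c x [v] \<noteq> 0" using nz[OF c x] by blast
      define U where "U = {y \<in> chart_ran c. \<alpha> c y [v] \<noteq> 0}"
      have "open (chart_ran c \<inter> (\<lambda>y. \<alpha> c y [v]) -` (- {0}))"
        by (rule continuous_open_preimage[OF smooth_on_continuous_on[OF form_smooth[OF \<alpha> c]] R]) auto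
      moreover have "chart_ran c \<inter> (\<lambda>y. \<alpha> c y [v]) -` (- {0}) = U" by (auto simp: U_def)
      ultimately have U: "open U" by simp
      have sub: "U \<subseteq> chart_ran c" by (auto simp: U_def)
      have "smooth_on U (\<lambda>y. \<rho> c y [v] / \<alpha> c y [v])"
        by (intro smooth_on_divide[OF U] smooth_on_subset[OF form_smooth[OF \<rho> c] sub]
            smooth_on_subset[OF form_smooth[OF \<alpha> c] sub]) (simp add: U_def)
      then have "smooth_on U (m c)"
        by (rule smooth_on_cong[OF U, rotated]) (use m[OF c] in \<open>auto simp: U_def\<close>)
      then show "\<exists>U. open U \<and> x \<in> U \<and> smooth_on U (m c)"
        using U x v by (auto simp: U_def)
    qed
  next
    fix c c' x assume c: "c \<in> A" "c' \<in> A" "x \<in> overlap c c'"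
    note x = overlap_in_ran[OF c(3)] and x' = transition_in_ran[OF c(1,3)]
    obtain v where v: "\<alpha> c x [v] \<noteq> 0" using nz[OF c(1) x] by blast
    let ?x' = "transition c c' x" and ?v' = "transition_deriv c c' x v"
    have "m c x * \<alpha> c x [v] = \<rho> c' ?x' [?v']"
      using form_transition[OF \<rho> c, of "[v]"] m[OF c(1) x, of v] by simp
    also have "\<dots> = m c' ?x' * \<alpha> c x [v]"
      using form_transition[OF \<alpha> c, of "[v]"] m[OF c(2) x', of ?v'] by simp
    finally show "m c x = m c' ?x'" using v by simp
  qed
  then show ?thesis using m by (intro exI[of _ \<mu>]) (simp add: \<mu>_def)
qed

section \<open>Smooth families of forms\<close>

lemma family_form: "smooth_form_family A I k \<omega> \<Longrightarrow> t \<in> I \<Longrightarrow> diff_form A k (\<omega> t)"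
  by (simp add: smooth_form_family_def)

text \<open>
  On lists of the wrong length all the forms of the family vanish, which makes smoothness hold for every list.
\<close>

lemma family_smooth:
  assumes I: "open I" and \<omega>: "smooth_form_family A I k \<omega>" and c: "c \<in> A"
  shows "smooth_on (I \<times> chart_ran c) (\<lambda>p. \<omega> (fst p) c (snd p) vs)"
proof (cases "length vs = k")
  case True
  then show ?thesis using \<omega> c by (simp add: smooth_form_family_def split_def)
next
  case False
  have "open (I \<times> chart_ran c)" by (intro open_Times I chart_ran_open is_chart c)
  moreover have "\<omega> (fst p) c (snd p) vs = 0" if "p \<in> I \<times> chart_ran c" for p
    by (rule form_length[OF family_form[OF \<omega>] False]) (use that in auto)
  ultimately show ?thesis
    by (intro smooth_on_cong[OF _ _ smooth_on_const[of _ 0]]) simp_all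
qed

context
  fixes I :: "real set" and k :: nat and \<omega> :: "real \<Rightarrow> ('m, 'e) form" and t :: real
  assumes I: "open I" and \<omega>: "smooth_form_family A I k \<omega>" and t: "t \<in> I"
begin

lemma dot_has_derivative:
  assumes "c \<in> A" "x \<in> chart_ran c"
  shows "((\<lambda>s. \<omega> s c x vs) has_real_derivative dot \<omega> t c x vs) (at t)"
    and "dot \<omega> t c x vs = dir_deriv (\<lambda>p. \<omega> (fst p) c (snd p) vs) (1, 0) (t, x)"
proof -
  have "(\<lambda>p. \<omega> (fst p) c (snd p) vs) differentiable (at (t, x))"
    by (rule smooth_on_differentiable[OF family_smooth[OF I \<omega> assms(1)]]) (use t assms in simp)
  from deriv_slice[OF this]
  have "((\<lambda>s. \<omega> s c x vs) has_real_derivative dir_deriv (\<lambda>p. \<omega> (fst p) c (snd p) vs) (1, 0) (t, x)) (at t)"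
    by simp
  moreover from DERIV_imp_deriv[OF this]
  show "dot \<omega> t c x vs = dir_deriv (\<lambda>p. \<omega> (fst p) c (snd p) vs) (1, 0) (t, x)"
    by (simp add: dot_def)
  ultimately show "((\<lambda>s. \<omega> s c x vs) has_real_derivative dot \<omega> t c x vs) (at t)"
    by simp
qed

text \<open>
  Every pointwise identity for the forms of a family can be differentiated in time. It needs to hold only
  within \<open>I\<close>, since \<open>I\<close> is open.
\<close>

lemma dot_unique:
  assumes "c \<in> A" "x \<in> chart_ran c" "\<And>s. s \<in> I \<Longrightarrow> \<omega> s c x vs = f s" "(f has_real_derivative d) (at t)"
  shows "dot \<omega> t c x vs = d"
proof (rule DERIV_unique)
  show "((\<lambda>s. \<omega> s c x vs) has_real_derivative dot \<omega> t c x vs) (at t)"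
    by (rule dot_has_derivative[OF assms(1,2)])
  show "((\<lambda>s. \<omega> s c x vs) has_real_derivative d) (at t)"
    by (rule has_field_derivative_transform_within_open[OF assms(4) I t]) (use assms(3) in simp)
qed

text \<open>
  Derivatives in time and in space commute, because they are second derivatives of one function on the
  product. Thus the exterior derivative of \<open>dot \<omega> t\<close> is the time derivative of the exterior derivatives.
\<close>

lemma dir_deriv_dot:
  assumes c: "c \<in> A" and x: "x \<in> chart_ran c"
  shows "((\<lambda>s. dir_deriv (\<lambda>y. \<omega> s c y vs) v x) has_real_derivative
    dir_deriv (\<lambda>y. dot \<omega> t c y vs) v x) (at t)"
proof -
  let ?J = "\<lambda>p. \<omega> (fst p) c (snd p) vs"
  let ?S = "I \<times> chart_ran c"
  have R: "open (chart_ran c)" by (rule chart_ran_open[OF is_chart[OF c]])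
  have S: "open ?S" by (intro open_Times I R)
  have tx: "(t, x) \<in> ?S" using t x by simp
  have J: "smooth_on ?S ?J" by (rule family_smooth[OF I \<omega> c])
  have "dir_deriv (\<lambda>y. dot \<omega> t c y vs) v x = dir_deriv (\<lambda>y. dir_deriv ?J (1, 0) (t, y)) v x"
    by (rule dir_deriv_cong[OF R x]) (rule dot_has_derivative(2)[OF c])
  also have "\<dots> = dir_deriv (\<lambda>p. dir_deriv ?J (1, 0) p) (0, v) (t, x)"
    by (rule dir_deriv_eqI,
        rule dir_deriv_slice[OF smooth_on_differentiable[OF smooth_on_dir_deriv[OF J] tx]])
  also have "\<dots> = dir_deriv (\<lambda>p. dir_deriv ?J (0, v) p) (1, 0) (t, x)"
    by (rule symmetric_second_derivative[OF S tx J])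
  finally have eq: "dir_deriv (\<lambda>y. dot \<omega> t c y vs) v x = \<dots>" .
  have "((\<lambda>s. dir_deriv ?J (0, v) (s, x)) has_real_derivative
      dir_deriv (\<lambda>p. dir_deriv ?J (0, v) p) (1, 0) (t, x)) (at t)"
    by (rule deriv_slice[OF smooth_on_differentiable[OF smooth_on_dir_deriv[OF J] tx]])
  then show ?thesis
    unfolding eq
  proof (rule has_field_derivative_transform_within_open[OF _ I t])
    fix s assume "s \<in> I"
    then have "((\<lambda>y. ?J (s, y)) has_derivative (\<lambda>v. dir_deriv ?J (0, v) (s, x))) (at x)"
      by (intro dir_deriv_slice smooth_on_differentiable[OF J]) (use x in simp)
    then show "dir_deriv ?J (0, v) (s, x) = dir_deriv (\<lambda>y. \<omega> s c y vs) v x"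
      using dir_deriv_eqI[of "\<lambda>y. ?J (s, y)" _ x v] by simp
  qed
qed

lemma diff_form_dot: "diff_form A k (dot \<omega> t)"
  unfolding diff_form_iff
proof (intro conjI ballI allI impI)
  show "dot \<omega> t c x = (\<lambda>_. 0)" if "c \<notin> A \<or> x \<notin> chart_ran c" for c x
  proof
    fix vs
    have "\<omega> s c x vs = 0" if "s \<in> I" for s
      using form_outside[OF family_form[OF \<omega> that] \<open>c \<notin> A \<or> x \<notin> chart_ran c\<close>] by simp
    then have "((\<lambda>s. \<omega> s c x vs) has_real_derivative 0) (at t)"
      by (intro has_field_derivative_transform_within_open[OF DERIV_const I t]) simp
    from DERIV_imp_deriv[OF this] show "dot \<omega> t c x vs = 0" by (simp add: dot_def)
  qed
  show "alternating_form k (dot \<omega> t c x)" if c: "c \<in> A" "x \<in> chart_ran c" for c x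
    unfolding alternating_form_def
  proof (intro conjI allI impI)
    show "dot \<omega> t c x vs = 0" if "length vs \<noteq> k" for vs
      by (rule dot_unique[OF c form_length[OF family_form[OF \<omega>] that] DERIV_const])
    show "dot \<omega> t c x vs = 0" if "length vs = k \<and> i < j \<and> j < k \<and> vs ! i = vs ! j" for vs i j
      by (rule dot_unique[OF c alternating_form_repeat[OF form_alternating[OF family_form[OF \<omega>]], of _ vs i j]
            DERIV_const]) (use that in auto)
    show "linear (\<lambda>v. dot \<omega> t c x (vs[i := v]))" if vs: "length vs = k \<and> i < k" for vs i
    proof -
      have lin: "linear (\<lambda>v. \<omega> s c x (vs[i := v]))" if "s \<in> I" for s
        by (rule alternating_form_linear[OF form_alternating[OF family_form[OF \<omega> that]]]) (use vs in auto)
      show ?thesis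
      proof (rule linearI)
        fix a b :: 'e and r :: real
        show "dot \<omega> t c x (vs[i := a + b]) = dot \<omega> t c x (vs[i := a]) + dot \<omega> t c x (vs[i := b])"
          by (rule dot_unique[OF c linear_add[OF lin]
                DERIV_add[OF dot_has_derivative(1)[OF c] dot_has_derivative(1)[OF c]]])
        show "dot \<omega> t c x (vs[i := r *\<^sub>R a]) = r *\<^sub>R dot \<omega> t c x (vs[i := a])"
          unfolding real_scaleR_def
          by (rule dot_unique[OF c _ DERIV_cmult[OF dot_has_derivative(1)[OF c]]])
            (use linear_scale[OF lin] in simp)
      qed
    qed
  qed
  show "smooth_on (chart_ran c) (\<lambda>x. dot \<omega> t c x vs)" if c: "c \<in> A" for c vs
  proof -
    have R: "open (chart_ran c)" by (rule chart_ran_open[OF is_chart[OF c]])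
    have "smooth_on (chart_ran c) (\<lambda>x. dir_deriv (\<lambda>p. \<omega> (fst p) c (snd p) vs) (1, 0) (t, x))"
      by (rule smooth_on_slice[OF open_Times[OF I R] smooth_on_dir_deriv[OF family_smooth[OF I \<omega> c]] _ R])
        (use t in simp)
    then show ?thesis
      by (rule smooth_on_cong[OF R, rotated]) (rule dot_has_derivative(2)[OF c, symmetric])
  qed
  show "dot \<omega> t c x vs = dot \<omega> t c' (transition c c' x) (map (transition_deriv c c' x) vs)"
    if c: "c \<in> A" "c' \<in> A" "x \<in> overlap c c'" and len: "length vs = k" for c c' x vs
    by (rule dot_unique[OF c(1) overlap_in_ran[OF c(3)] form_transition[OF family_form[OF \<omega>] c len]
          dot_has_derivative(1)[OF c(2) transition_in_ran[OF c(1,3)]]])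
qed

end

end

section \<open>Variation of the Godbillon-Vey form\<close>

text \<open>
  At a point where \<open>a\<close> does not vanish, \<open>a \<and> B = 0\<close> means that \<open>B = a \<and> \<gamma>\<close> for some \<open>\<gamma>\<close>. Hence \<open>B \<and> B = 0\<close>, and
  a covector \<open>q\<close> with \<open>a \<and> q = f B\<close> is a combination of \<open>a\<close> and \<open>\<gamma>\<close>, so that \<open>q \<and> b \<and> B = 0\<close> for every \<open>b\<close>.
\<close>

lemma decomposable_two_form:
  fixes a :: "'a \<Rightarrow> real" and B :: "'a \<Rightarrow> 'a \<Rightarrow> real"
  assumes z: "a z \<noteq> 0"
    and C: "\<And>u v w. a u * B v w - a v * B u w + a w * B u v = 0"
  shows "B v w = a v * (B z w / a z) - a w * (B z v / a z)"
  using C[of z v w] z by (simp add: field_simps)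

lemma wedge_square_zero:
  fixes a :: "'a \<Rightarrow> real" and B :: "'a \<Rightarrow> 'a \<Rightarrow> real"
  assumes "a z \<noteq> 0" "\<And>u v w. a u * B v w - a v * B u w + a w * B u v = 0"
  shows "B p q * B r s - B p r * B q s + B p s * B q r = 0"
proof -
  define \<gamma> where "\<gamma> w = B z w / a z" for w
  have \<gamma>: "B v w = a v * \<gamma> w - a w * \<gamma> v" for v w
    unfolding \<gamma>_def by (rule decomposable_two_form[where a = a and B = B, OF assms])
  show ?thesis unfolding \<gamma> by (simp add: algebra_simps)
qed

lemma wedge_with_factor_zero:
  fixes a q b :: "'a \<Rightarrow> real" and B :: "'a \<Rightarrow> 'a \<Rightarrow> real"
  assumes z: "a z \<noteq> 0" and C: "\<And>u v w. a u * B v w - a v * B u w + a w * B u v = 0"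
    and E: "\<And>v w. a v * q w - a w * q v = f * B v w"
  shows "(q v1 * b v2 - q v2 * b v1) * B v3 v4 - (q v1 * b v3 - q v3 * b v1) * B v2 v4
    + (q v1 * b v4 - q v4 * b v1) * B v2 v3 + (q v2 * b v3 - q v3 * b v2) * B v1 v4
    - (q v2 * b v4 - q v4 * b v2) * B v1 v3 + (q v3 * b v4 - q v4 * b v3) * B v1 v2 = 0"
proof -
  define \<gamma> where "\<gamma> w = B z w / a z" for w
  have \<gamma>: "B v w = a v * \<gamma> w - a w * \<gamma> v" for v w
    unfolding \<gamma>_def by (rule decomposable_two_form[where a = a and B = B, OF z C])
  define k where "k = q z / a z"
  have q: "q w = k * a w + f * \<gamma> w" for w
    using E[of z w] z by (simp add: k_def \<gamma>_def field_simps)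
  show ?thesis
    unfolding \<gamma> q[of v1] q[of v2] q[of v3] q[of v4]
    by (simp add: algebra_simps)
qed

context smooth_atlas
begin

text \<open>
  The primitive of the form \<open>\<beta>' \<and> \<beta> \<and> d\<beta>\<close> is \<open>\<mu> \<beta> \<and> d\<beta>\<close>, where \<open>\<mu>\<close> is the factor of \<open>\<alpha>\<close> in the formula for the
  variation of \<open>\<alpha>\<close>. The proof works in one chart at one point: \<open>E\<close> is the equation \<open>\<alpha> \<and> (\<beta>' - d\<mu>) = \<phi> d\<beta>\<close>, and \<open>C\<close> is
  \<open>\<alpha> \<and> d\<beta> = 0\<close>.
\<close>

lemma TGV_zero_if_variation:
  assumes I: "open I" and t: "t \<in> I"
    and \<alpha>: "smooth_form_family A I 1 \<alpha>" and \<beta>: "smooth_form_family A I 1 \<beta>"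
    and d\<alpha>: "\<And>s. s \<in> I \<Longrightarrow> ext_d 1 (\<alpha> s) = wedge 1 1 (\<alpha> s) (\<beta> s)"
    and nz: "\<And>c x. c \<in> A \<Longrightarrow> x \<in> chart_ran c \<Longrightarrow> \<exists>v. \<alpha> t c x [v] \<noteq> 0"
    and \<phi>: "diff_form A 0 \<phi>"
    and variation: "\<And>c x. c \<in> A \<Longrightarrow> x \<in> chart_ran c \<Longrightarrow> \<exists>m. \<forall>v.
      dot \<alpha> t c x [v] = \<phi> c x [] * \<beta> t c x [v] + ext_d 0 \<phi> c x [v] - m * \<alpha> t c x [v]"
  shows "TGV A \<beta> t \<in> de_Rham A 4 \<and> TGV A \<beta> t = de_Rham_zero A 4"
proof -
  note \<alpha>t = family_form[OF \<alpha> t] and \<beta>t = family_form[OF \<beta> t]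
  note \<alpha>' = diff_form_dot[OF I \<alpha> t] and \<beta>' = diff_form_dot[OF I \<beta> t]
  define \<rho> where "\<rho> = (\<lambda>c x vs. wedge 0 1 \<phi> (\<beta> t) c x vs - (dot \<alpha> t c x vs - ext_d 0 \<phi> c x vs))"
  have "diff_form A 1 \<rho>"
    unfolding \<rho>_def using diff_form_wedge[OF \<phi> \<beta>t]
    by (intro diff_form_diff[OF _ diff_form_diff[OF \<alpha>' diff_form_ext_d_0[OF \<phi>]]]) simp
  moreover have "\<exists>m. \<forall>v. \<rho> c x [v] = m * \<alpha> t c x [v]" if "c \<in> A" "x \<in> chart_ran c" for c x
    using variation[OF that] by (auto simp: \<rho>_def wedge_0_1[unfolded One_nat_def])
  ultimately obtain \<mu> where \<mu>: "diff_form A 0 \<mu>"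
    and \<rho>\<mu>: "\<And>c x v. c \<in> A \<Longrightarrow> x \<in> chart_ran c \<Longrightarrow> \<rho> c x [v] = \<mu> c x [] * \<alpha> t c x [v]"
    using proportional_forms[OF _ \<alpha>t nz] by metis
  define B where "B = ext_d 1 (\<beta> t)"
  have B: "diff_form A 2 B" unfolding B_def by (rule diff_form_ext_d_1[OF \<beta>t])
  define \<theta> where "\<theta> = wedge 1 2 (wedge 0 1 \<mu> (\<beta> t)) B"
  have \<theta>: "diff_form A 3 \<theta>"
    using diff_form_wedge[OF diff_form_wedge[OF \<mu> \<beta>t, unfolded add_0] B] by (simp add: \<theta>_def numeral_3_eq_3)
  have b'b: "diff_form A 2 (wedge 1 1 (dot \<beta> t) (\<beta> t))"
    using diff_form_wedge[OF \<beta>' \<beta>t] by (simp add: numeral_2_eq_2)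
  have TGV: "diff_form A 4 (TGV_form \<beta> t)"
    using diff_form_wedge[OF b'b B] by (simp add: TGV_form_def B_def)
  have exact: "TGV_form \<beta> t = ext_d 3 \<theta>"
  proof (intro ext)
    fix c x and vs :: "'e list"
    show "TGV_form \<beta> t c x vs = ext_d 3 \<theta> c x vs"
    proof (cases "c \<in> A \<and> x \<in> chart_ran c \<and> length vs = 4")
      case False
      then consider "c \<notin> A \<or> x \<notin> chart_ran c" | "length vs \<noteq> 4" by blast
      then show ?thesis
      proof cases
        case 1
        then show ?thesis using form_outside[OF TGV 1] ext_d_outside[OF \<theta> 1] by simp
      next
        case 2
        then show ?thesis using form_length[OF TGV 2] by (simp add: ext_d_def)
      qed
    next
      case True
      then have c: "c \<in> A" and x: "x \<in> chart_ran c" and len: "length vs = 4" by auto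
      obtain v1 v2 v3 v4 where vs: "vs = [v1, v2, v3, v4]"
        using len by (auto simp: numeral_eq_Suc length_Suc_conv)
      have R: "open (chart_ran c)" by (rule chart_ran_open[OF is_chart[OF c]])
      define a where "a v = \<alpha> t c x [v]" for v
      define b where "b v = \<beta> t c x [v]" for v
      define a' where "a' v = dot \<alpha> t c x [v]" for v
      define b' where "b' v = dot \<beta> t c x [v]" for v
      define f where "f = \<phi> c x []"
      define m where "m = \<mu> c x []"
      define df where "df v = dir_deriv (\<lambda>y. \<phi> c y []) v x" for v
      define dm where "dm v = dir_deriv (\<lambda>y. \<mu> c y []) v x" for v
      define Da where "Da v w = dir_deriv (\<lambda>y. \<alpha> t c y [w]) v x" for v w
      define Db where "Db v w = dir_deriv (\<lambda>y. \<beta> t c y [w]) v x" for v w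
      define Da' where "Da' v w = dir_deriv (\<lambda>y. dot \<alpha> t c y [w]) v x" for v w
      define Ddf where "Ddf v w = dir_deriv (\<lambda>y. dir_deriv (\<lambda>y. \<phi> c y []) w y) v x" for v w
      define DB where "DB u v w = dir_deriv (\<lambda>y. B c y [v, w]) u x" for u v w
      define Bx where "Bx v w = B c x [v, w]" for v w
      note defs = a_def b_def a'_def b'_def f_def m_def df_def dm_def Da_def Db_def Da'_def Ddf_def
        DB_def Bx_def
      note diffs = form_differentiable[OF \<alpha>t c x] form_differentiable[OF \<beta>t c x]
        form_differentiable[OF \<phi> c x] form_differentiable[OF \<mu> c x] form_differentiable[OF \<alpha>' c x]
        form_differentiable[OF B c x]
        smooth_on_differentiable[OF smooth_on_dir_deriv[OF form_smooth[OF \<phi> c]] x]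
      have Bx: "Bx v w = Db v w - Db w v" for v w
        unfolding defs B_def by (rule ext_d_1[OF x])
      have da: "\<alpha> s c y [v] * \<beta> s c y [w] - \<alpha> s c y [w] * \<beta> s c y [v] =
          dir_deriv (\<lambda>y. \<alpha> s c y [w]) v y - dir_deriv (\<lambda>y. \<alpha> s c y [v]) w y"
        if "s \<in> I" "y \<in> chart_ran c" for s y v w
        using ext_d_1[OF that(2), of "\<alpha> s" v w] unfolding d\<alpha>[OF that(1)] wedge_1_1 .
      have 1: "a' v = f * b v + df v - m * a v" for v
        using \<rho>\<mu>[OF c x, of v] by (simp add: \<rho>_def wedge_0_1[unfolded One_nat_def] ext_d_0[OF x] defs)
      have 2: "Da v w - Da w v = a v * b w - a w * b v" for v w
        using da[OF t x, of v w] by (simp add: defs)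
      \<comment> \<open>The time derivative of \<open>d\<alpha> = \<alpha> \<and> \<beta>\<close>.\<close>
      have 3: "Da' v w - Da' w v = a' v * b w + a v * b' w - a' w * b v - a w * b' v" for v w
      proof (rule DERIV_unique)
        show "((\<lambda>s. dir_deriv (\<lambda>y. \<alpha> s c y [w]) v x - dir_deriv (\<lambda>y. \<alpha> s c y [v]) w x)
            has_real_derivative Da' v w - Da' w v) (at t)"
          unfolding defs by (intro DERIV_diff dir_deriv_dot[OF I \<alpha> t c x])
        have "((\<lambda>s. \<alpha> s c x [v] * \<beta> s c x [w] - \<alpha> s c x [w] * \<beta> s c x [v])
            has_real_derivative (a' v * b w + b' w * a v) - (a' w * b v + b' v * a w)) (at t)"
          unfolding defs by (intro DERIV_diff DERIV_mult dot_has_derivative(1)[OF I \<alpha> t c x]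
              dot_has_derivative(1)[OF I \<beta> t c x])
        then have "((\<lambda>s. dir_deriv (\<lambda>y. \<alpha> s c y [w]) v x - dir_deriv (\<lambda>y. \<alpha> s c y [v]) w x)
            has_real_derivative (a' v * b w + b' w * a v) - (a' w * b v + b' v * a w)) (at t)"
          by (rule has_field_derivative_transform_within_open[OF _ I t]) (rule da[OF _ x])
        then show "((\<lambda>s. dir_deriv (\<lambda>y. \<alpha> s c y [w]) v x - dir_deriv (\<lambda>y. \<alpha> s c y [v]) w x)
            has_real_derivative a' v * b w + a v * b' w - a' w * b v - a w * b' v) (at t)"
          by (simp add: algebra_simps)
      qed
      \<comment> \<open>The derivative of \<open>\<phi> \<beta> - (\<alpha>' - d\<phi>) = \<mu> \<alpha>\<close> in the direction \<open>v\<close>; its antisymmetric part is the exterior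
        derivative.\<close>
      have 4: "f * Db v w + df v * b w - (Da' v w - Ddf v w) = m * Da v w + dm v * a w" for v w
      proof -
        have "dir_deriv (\<lambda>y. \<phi> c y [] * \<beta> t c y [w] - (dot \<alpha> t c y [w] - dir_deriv (\<lambda>y. \<phi> c y []) w y)) v x
            = f * Db v w + df v * b w - (Da' v w - Ddf v w)"
          unfolding defs
          by (rule dir_deriv_eqI, intro has_derivative_diff has_derivative_mult dir_deriv_works diffs)
        moreover have "dir_deriv (\<lambda>y. \<mu> c y [] * \<alpha> t c y [w]) v x = m * Da v w + dm v * a w"
          unfolding defs by (rule dir_deriv_eqI, intro has_derivative_mult dir_deriv_works diffs)
        moreover have "\<phi> c y [] * \<beta> t c y [w] - (dot \<alpha> t c y [w] - dir_deriv (\<lambda>y. \<phi> c y []) w y)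
            = \<mu> c y [] * \<alpha> t c y [w]" if "y \<in> chart_ran c" for y
          using \<rho>\<mu>[OF c that, of w] by (simp add: \<rho>_def wedge_0_1[unfolded One_nat_def] ext_d_0[OF that])
        then have "dir_deriv (\<lambda>y. \<phi> c y [] * \<beta> t c y [w] - (dot \<alpha> t c y [w] - dir_deriv (\<lambda>y. \<phi> c y []) w y)) v x
            = dir_deriv (\<lambda>y. \<mu> c y [] * \<alpha> t c y [w]) v x"
          by (rule dir_deriv_cong[OF R x])
        ultimately show ?thesis by (simp only:)
      qed
      have sym: "Ddf v w = Ddf w v" for v w
        unfolding defs by (rule symmetric_second_derivative[OF R x form_smooth[OF \<phi> c]])
      have E: "a v * (b' w - dm w) - a w * (b' v - dm v) = f * Bx v w" for v w
      proof -
        have "f * Bx v w = (m * Da v w + dm v * a w - df v * b w + Da' v w - Ddf v w)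
            - (m * Da w v + dm w * a v - df w * b v + Da' w v - Ddf w v)"
          using 4[of v w] 4[of w v] by (simp add: Bx algebra_simps)
        also have "\<dots> = m * (Da v w - Da w v) + (Da' v w - Da' w v)
            + dm v * a w - dm w * a v - df v * b w + df w * b v"
          using sym[of v w] by (simp add: algebra_simps)
        also have "\<dots> = a v * (b' w - dm w) - a w * (b' v - dm v)"
          unfolding 2 3 1 by (simp add: algebra_simps)
        finally show ?thesis by simp
      qed
      have C: "a u * Bx v w - a v * Bx u w + a w * Bx u v = 0" for u v w
      proof -
        have D: "dir_deriv (\<lambda>y. ext_d 1 (\<alpha> t) c y [v, w]) u x
            = (a v * Db u w + Da u v * b w) - (a w * Db u v + Da u w * b v)" for u v w
          unfolding d\<alpha>[OF t] wedge_1_1 defs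
          by (rule dir_deriv_eqI, intro has_derivative_diff has_derivative_mult dir_deriv_works diffs)
        have "ext_d 2 (ext_d 1 (\<alpha> t)) c x [u, v, w] = 0"
          using ext_d_ext_d[OF \<alpha>t] by (simp add: numeral_2_eq_2 zero_form_def)
        then have "a u * Bx v w - a v * Bx u w + a w * Bx u v
            = b w * (Da u v - Da v u) - b v * (Da u w - Da w u) + b u * (Da v w - Da w v)"
          unfolding ext_d_2[OF x] D by (simp add: Bx algebra_simps)
        also have "\<dots> = 0" unfolding 2 by (simp add: algebra_simps)
        finally show ?thesis .
      qed
      have dB: "DB u v w - DB v u w + DB w u v = 0" for u v w
      proof -
        have "ext_d 2 B c x [u, v, w] = 0"
          unfolding B_def using ext_d_ext_d[OF \<beta>t] by (simp add: numeral_2_eq_2 zero_form_def)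
        then show ?thesis unfolding ext_d_2[OF x] defs .
      qed
      obtain z where z: "a z \<noteq> 0" using nz[OF c x] by (auto simp: defs)
      have D\<theta>: "dir_deriv (\<lambda>y. \<theta> c y [p, q, r]) u x =
          (m * b p) * DB u q r + (m * Db u p + dm u * b p) * Bx q r
          - ((m * b q) * DB u p r + (m * Db u q + dm u * b q) * Bx p r)
          + ((m * b r) * DB u p q + (m * Db u r + dm u * b r) * Bx p q)" for u p q r
        unfolding \<theta>_def wedge_1_2[OF form_alternating[OF B]] wedge_0_1 defs
        by (rule dir_deriv_eqI,
            intro has_derivative_add has_derivative_diff has_derivative_mult dir_deriv_works diffs)
      \<comment> \<open>\<open>X\<close> is half of \<open>d\<beta> \<and> d\<beta>\<close>, and \<open>W q\<close> is \<open>q \<and> \<beta> \<and> d\<beta>\<close>, evaluated on the four vectors.\<close>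
      define X where "X = Bx v1 v2 * Bx v3 v4 - Bx v1 v3 * Bx v2 v4 + Bx v1 v4 * Bx v2 v3"
      have X: "X = 0" unfolding X_def by (rule wedge_square_zero[where a = a and B = Bx, OF z C])
      define W where "W q = (q v1 * b v2 - q v2 * b v1) * Bx v3 v4 - (q v1 * b v3 - q v3 * b v1) * Bx v2 v4
        + (q v1 * b v4 - q v4 * b v1) * Bx v2 v3 + (q v2 * b v3 - q v3 * b v2) * Bx v1 v4
        - (q v2 * b v4 - q v4 * b v2) * Bx v1 v3 + (q v3 * b v4 - q v4 * b v3) * Bx v1 v2" for q
      have "W (\<lambda>v. b' v - dm v) = 0"
        unfolding W_def by (rule wedge_with_factor_zero[where a = a and B = Bx and f = f, OF z C E])
      then have "W b' = W dm" by (simp add: W_def algebra_simps)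
      have "TGV_form \<beta> t c x vs = W b'"
        unfolding TGV_form_def vs wedge_2_2[OF form_alternating[OF b'b] form_alternating[OF B[unfolded B_def]]]
          wedge_1_1 W_def defs B_def by simp
      also note \<open>W b' = W dm\<close>
      also have "W dm = ext_d 3 \<theta> c x vs"
      proof -
        \<comment> \<open>The Leibniz rule: \<open>d(\<mu> \<beta> \<and> B) = d\<mu> \<and> \<beta> \<and> B + \<mu> d\<beta> \<and> B - \<mu> \<beta> \<and> dB\<close>.\<close>
        have "ext_d 3 \<theta> c x vs = W dm
            + m * ((Db v1 v2 - Db v2 v1) * Bx v3 v4 - (Db v1 v3 - Db v3 v1) * Bx v2 v4
              + (Db v1 v4 - Db v4 v1) * Bx v2 v3 + (Db v2 v3 - Db v3 v2) * Bx v1 v4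
              - (Db v2 v4 - Db v4 v2) * Bx v1 v3 + (Db v3 v4 - Db v4 v3) * Bx v1 v2)
            - m * (b v1 * (DB v2 v3 v4 - DB v3 v2 v4 + DB v4 v2 v3)
              - b v2 * (DB v1 v3 v4 - DB v3 v1 v4 + DB v4 v1 v3)
              + b v3 * (DB v1 v2 v4 - DB v2 v1 v4 + DB v4 v1 v2)
              - b v4 * (DB v1 v2 v3 - DB v2 v1 v3 + DB v3 v1 v2))"
          unfolding vs ext_d_3[OF x] D\<theta> W_def by (simp add: algebra_simps)
        also have "\<dots> = W dm + 2 * m * X"
          unfolding dB Bx[symmetric] X_def by (simp add: algebra_simps)
        finally show ?thesis by (simp add: X)
      qed
      finally show ?thesis .
    qed
  qed
  have "ext_d 4 (TGV_form \<beta> t) = zero_form"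
    unfolding exact using ext_d_ext_d[OF \<theta>] by simp
  then have "closed_form A (Suc 3) (TGV_form \<beta> t)"
    using TGV by (simp add: closed_form_def)
  moreover have "exact_form A (Suc 3) (TGV_form \<beta> t)"
    unfolding exact_form_def nat.case using \<theta> exact by blast
  ultimately show ?thesis
    unfolding TGV_def using exact_imp_de_Rham_zero[of 3 "TGV_form \<beta> t"] by simp
qed

end

section \<open>Families of pulled back foliations\<close>

lemma transverse_axis_in_Basis: "(transverse_axis :: 'e::euclidean_space) \<in> Basis"
  unfolding transverse_axis_def by (rule someI_ex) (use nonempty_Basis in blast)

locale pullback_family = smooth_atlas A
  for A :: "('m::{t2_space, second_countable_topology}, 'e::euclidean_space) chart set" +
  fixes F :: "('m, 'e) chart set" and I :: "real set" and \<Phi> :: "real \<Rightarrow> 'm \<Rightarrow> 'm"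
  assumes foliation: "oriented_foliation A F"
    and open_I: "open I"
    and family: "smooth_diffeo_family A I \<Phi>"
begin

lemma foliated_chart: "d \<in> F \<Longrightarrow> d \<in> A"
  using foliation unfolding oriented_foliation_def by blast

lemma foliated_chart_at: obtains d where "d \<in> F" "p \<in> chart_dom d"
proof -
  have "(\<Union>d\<in>F. chart_dom d) = UNIV" using foliation unfolding oriented_foliation_def by blast
  then show ?thesis using that by blast
qed

text \<open>
  In the chart \<open>c\<close>, the leaves of the foliation at time \<open>s\<close> are locally the level sets of \<open>leaf_fun d c\<close> at time \<open>s\<close>. It
  is treated as a single function of time and space, in order to interchange the two kinds of derivatives.
\<close>

definition leaf_dom :: "('m, 'e) chart \<Rightarrow> ('m, 'e) chart \<Rightarrow> (real \<times> 'e) set" where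
  "leaf_dom d c = {(s, y). s \<in> I \<and> y \<in> chart_ran c \<and> \<Phi> s (chart_inv c y) \<in> chart_dom d}"

definition leaf_fun :: "('m, 'e) chart \<Rightarrow> ('m, 'e) chart \<Rightarrow> real \<times> 'e \<Rightarrow> real" where
  "leaf_fun d c = (\<lambda>(s, y). transverse_coord d (\<Phi> s (chart_inv c y)))"

lemma open_flow_preimage:
  assumes c: "c \<in> A" and W: "open W"
  shows "open {(s, y). s \<in> I \<and> y \<in> chart_ran c \<and> \<Phi> s (chart_inv c y) \<in> W}"
proof -
  let ?S = "I \<times> chart_ran c"
  have S: "open ?S" by (intro open_Times open_I chart_ran_open is_chart c)
  have inv: "continuous_on (chart_ran c) (chart_inv c)"
    by (rule chart_inv_continuous[OF is_chart[OF c]])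
  have "continuous_on ?S (\<lambda>p. (fst p, chart_inv c (snd p)))"
    by (intro continuous_on_Pair continuous_on_fst continuous_on_id
        continuous_on_compose2[OF inv continuous_on_snd[OF continuous_on_id]]) auto
  moreover have \<Phi>: "continuous_on (I \<times> UNIV) (\<lambda>(t, p). \<Phi> t p)"
    using family unfolding smooth_diffeo_family_def by blast
  ultimately have "continuous_on ?S (\<lambda>p. (\<lambda>(t, p). \<Phi> t p) (fst p, chart_inv c (snd p)))"
    by (intro continuous_on_compose2[OF \<Phi>]) auto
  from continuous_open_preimage[OF this S W]
  have "open (?S \<inter> (\<lambda>p. \<Phi> (fst p) (chart_inv c (snd p))) -` W)" by simp
  moreover have "?S \<inter> (\<lambda>p. \<Phi> (fst p) (chart_inv c (snd p))) -` W
      = {(s, y). s \<in> I \<and> y \<in> chart_ran c \<and> \<Phi> s (chart_inv c y) \<in> W}" by auto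
  ultimately show ?thesis by (simp only:)
qed

lemma open_leaf_dom: "c \<in> A \<Longrightarrow> d \<in> F \<Longrightarrow> open (leaf_dom d c)"
  unfolding leaf_dom_def
  by (rule open_flow_preimage[OF _ chart_dom_open[OF is_chart[OF foliated_chart]]])

lemma smooth_leaf_fun:
  assumes c: "c \<in> A" and d: "d \<in> F"
  shows "smooth_on (leaf_dom d c) (leaf_fun d c)"
proof -
  have "smooth_on (leaf_dom d c) (\<lambda>(s, y). chart_map d (\<Phi> s (chart_inv c y)))"
    using family foliated_chart[OF d] c unfolding smooth_diffeo_family_def leaf_dom_def by blast
  from smooth_on_linear[OF open_leaf_dom[OF c d] bounded_linear_inner_left[of transverse_axis] this]
  show ?thesis by (simp add: leaf_fun_def transverse_coord_def split_def)
qed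

lemma leaf_fun_differentiable:
  assumes "c \<in> A" "d \<in> F" "p \<in> leaf_dom d c"
  shows "leaf_fun d c differentiable (at p)"
  by (rule smooth_on_differentiable[OF smooth_leaf_fun[OF assms(1,2)] assms(3)])

text \<open>
  The coordinate change of the foliated charts does not depend on time, so that it changes the
  derivatives in time and space by the same factor.
\<close>

lemma leaf_fun_change_foliated_chart:
  assumes c: "c \<in> A" and d: "d \<in> F" "d' \<in> F"
    and p: "(t, x) \<in> leaf_dom d c" "(t, x) \<in> leaf_dom d' c"
  shows "\<exists>k. \<forall>w. dir_deriv (leaf_fun d' c) w (t, x) = k * dir_deriv (leaf_fun d c) w (t, x)"
proof -
  let ?q = "\<Phi> t (chart_inv c x)"
  have q: "?q \<in> chart_dom d \<inter> chart_dom d'" using p by (simp add: leaf_dom_def)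
  have "\<exists>W J. \<exists>h :: real \<Rightarrow> real. open W \<and> ?q \<in> W \<and> W \<subseteq> chart_dom d \<inter> chart_dom d' \<and>
      open J \<and> smooth_on J h \<and> (\<forall>s\<in>J. deriv h s > 0) \<and>
      (\<forall>q\<in>W. transverse_coord d q \<in> J \<and> transverse_coord d' q = h (transverse_coord d q))"
    using foliation d q unfolding oriented_foliation_def by blast
  then obtain W J and h :: "real \<Rightarrow> real" where W: "open W" "?q \<in> W" and h: "smooth_on J h"
    and Wh: "\<And>q. q \<in> W \<Longrightarrow> transverse_coord d q \<in> J \<and> transverse_coord d' q = h (transverse_coord d q)"
    by blast
  define U where "U = {(s, y). s \<in> I \<and> y \<in> chart_ran c \<and> \<Phi> s (chart_inv c y) \<in> W}"
  have U: "open U" unfolding U_def by (rule open_flow_preimage[OF c W(1)])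
  have tx: "(t, x) \<in> U" using p W by (simp add: U_def leaf_dom_def)
  have "leaf_fun d c (t, x) \<in> J" using Wh[OF W(2)] by (simp add: leaf_fun_def)
  then have "h differentiable (at (leaf_fun d c (t, x)))" by (rule smooth_on_differentiable[OF h])
  then obtain k where k: "(h has_real_derivative k) (at (leaf_fun d c (t, x)))"
    using real_differentiableE by blast
  have "dir_deriv (leaf_fun d' c) w (t, x) = k * dir_deriv (leaf_fun d c) w (t, x)" for w
  proof -
    have "dir_deriv (leaf_fun d' c) w (t, x) = dir_deriv (\<lambda>p. h (leaf_fun d c p)) w (t, x)"
      by (rule dir_deriv_cong[OF U tx]) (use Wh in \<open>auto simp: U_def leaf_fun_def\<close>)
    also have "\<dots> = k * dir_deriv (leaf_fun d c) w (t, x)"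
      by (rule dir_deriv_eqI, rule has_derivative_compose[OF dir_deriv_works[OF leaf_fun_differentiable[OF c d(1) p(1)]]
          k[unfolded has_field_derivative_def]])
    finally show ?thesis .
  qed
  then show ?thesis by blast
qed

lemma leaf_dom_transition:
  assumes "c \<in> A" "c' \<in> A" "x \<in> overlap c c'"
  shows "(t, transition c c' x) \<in> leaf_dom d c' \<longleftrightarrow> (t, x) \<in> leaf_dom d c"
    and "leaf_fun d c' (t, transition c c' x) = leaf_fun d c (t, x)"
proof -
  have "chart_inv c x \<in> chart_dom c'"
    using assms(3) unfolding overlap_altdef[OF is_chart[OF assms(1)]] by simp
  then have "chart_inv c' (transition c c' x) = chart_inv c x"
    by (simp add: transition_def chart_inv_chart_map[OF is_chart[OF assms(2)]])
  then show "(t, transition c c' x) \<in> leaf_dom d c' \<longleftrightarrow> (t, x) \<in> leaf_dom d c"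
    and "leaf_fun d c' (t, transition c c' x) = leaf_fun d c (t, x)"
    using overlap_in_ran[OF assms(3)] transition_in_ran[OF assms(1,3)]
    by (simp_all add: leaf_dom_def leaf_fun_def)
qed

lemma leaf_fun_change_chart:
  assumes c: "c \<in> A" "c' \<in> A" "x \<in> overlap c c'" and d: "d \<in> F" and p: "(t, x) \<in> leaf_dom d c"
  shows "dir_deriv (leaf_fun d c) (r, v) (t, x) =
    dir_deriv (leaf_fun d c') (r, transition_deriv c c' x v) (t, transition c c' x)"
proof -
  let ?T = "\<lambda>p. (fst p, transition c c' (snd p))"
  have T: "(?T has_derivative (\<lambda>w. (fst w, transition_deriv c c' x (snd w)))) (at (t, x))"
    by (intro has_derivative_Pair has_derivative_fst has_derivative_ident
        has_derivative_compose[OF has_derivative_snd[OF has_derivative_ident]])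
      (use transition_derivative[OF c] in simp)
  have p': "(t, transition c c' x) \<in> leaf_dom d c'"
    using p leaf_dom_transition(1)[OF c] by simp
  have S: "open (I \<times> overlap c c')"
    by (intro open_Times open_I open_overlap is_chart c)
  have tx: "(t, x) \<in> I \<times> overlap c c'" using p c by (simp add: leaf_dom_def)
  have "dir_deriv (leaf_fun d c) (r, v) (t, x) = dir_deriv (\<lambda>p. leaf_fun d c' (?T p)) (r, v) (t, x)"
  proof (rule dir_deriv_cong[OF S tx])
    fix q assume "q \<in> I \<times> overlap c c'"
    then show "leaf_fun d c q = leaf_fun d c' (?T q)"
      using leaf_dom_transition(2)[OF c(1,2), of "snd q" d "fst q"] by auto
  qed
  also have "\<dots> = dir_deriv (leaf_fun d c') (r, transition_deriv c c' x v) (t, transition c c' x)"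
  proof -
    have "(leaf_fun d c' has_derivative (\<lambda>w. dir_deriv (leaf_fun d c') w (?T (t, x)))) (at (?T (t, x)))"
      using dir_deriv_works[OF leaf_fun_differentiable[OF c(2) d p']] by simp
    from dir_deriv_eqI[OF has_derivative_compose[OF T this], of "(r, v)"] show ?thesis by simp
  qed
  finally show ?thesis .
qed

text \<open>
  In the pulled back foliated chart \<open>e\<close> at time \<open>s\<close>, the leaf function is the transverse coordinate, and a one-form
  with the correct kernel is a multiple of its derivative. The representative of \<open>\<alpha>\<close> in \<open>e\<close> is not zero, so that
  \<open>e\<close> belongs to the atlas and the equation can be transformed to any other chart.
\<close>

lemma defining_form_leaf_fun:
  assumes s: "s \<in> I" and \<alpha>: "defining_form A (pullback_foliation (\<Phi> s) F) \<alpha>"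
    and c: "c \<in> A" and d: "d \<in> F" and y: "(s, y) \<in> leaf_dom d c"
  shows "\<exists>g. \<forall>v. \<alpha> c y [v] = g * dir_deriv (leaf_fun d c) (0, v) (s, y)"
    and "\<exists>v. \<alpha> c y [v] \<noteq> 0"
proof -
  let ?ax = "transverse_axis :: 'e"
  have form: "diff_form A 1 \<alpha>" using \<alpha> by (simp add: defining_form_def)
  define e where "e = (\<Phi> s -` chart_dom d, chart_map d \<circ> \<Phi> s)"
  define z where "z = chart_map e (chart_inv c y)"
  have q: "chart_inv c y \<in> chart_dom e" "chart_inv c y \<in> chart_dom c"
    using y chart_inv_in_dom[of y c] by (simp_all add: leaf_dom_def e_def)
  have z: "z \<in> chart_ran e" unfolding z_def by (rule chart_map_in_ran[OF q(1)])
  have "e \<in> pullback_foliation (\<Phi> s) F" using d by (simp add: pullback_foliation_def e_def)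
  then have def: "(\<alpha> e z [v] = 0 \<longleftrightarrow> v \<bullet> ?ax = 0) \<and> (v \<bullet> ?ax > 0 \<longrightarrow> \<alpha> e z [v] > 0)" for v
    using \<alpha> z unfolding defining_form_def by blast
  have ax: "?ax \<bullet> ?ax = 1" by (rule inner_same_Basis[OF transverse_axis_in_Basis])
  then have nz: "\<alpha> e z [?ax] \<noteq> 0" using def[of ?ax] by simp
  have e: "e \<in> A"
  proof (rule ccontr)
    assume "e \<notin> A"
    then have "\<alpha> e z = (\<lambda>_. 0)" by (intro form_outside[OF form]) simp
    with nz show False by simp
  qed
  have ran: "y \<in> chart_ran c" using y by (simp add: leaf_dom_def)
  have over: "y \<in> overlap c e"
    using q ran by (simp add: overlap_altdef[OF is_chart[OF c]])
  have trans: "transition c e y = z" by (simp add: transition_def z_def)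
  note lin = form_linear_1[OF form, of e z]
  have split: "\<alpha> e z [w] = \<alpha> e z [?ax] * (w \<bullet> ?ax)" for w
  proof -
    have "\<alpha> e z [w - (w \<bullet> ?ax) *\<^sub>R ?ax] = 0"
      using def[of "w - (w \<bullet> ?ax) *\<^sub>R ?ax"] ax by (simp add: inner_diff_left)
    then show ?thesis using linear_diff[OF lin] linear_scale[OF lin] by simp
  qed
  have "dir_deriv (leaf_fun d c) (0, v) (s, y) = transition_deriv c e y v \<bullet> ?ax" for v
  proof -
    have "(\<lambda>y'. leaf_fun d c (s, y')) = (\<lambda>y'. transition c e y' \<bullet> ?ax)"
      by (simp add: fun_eq_iff leaf_fun_def transverse_coord_def transition_def e_def)
    then have "dir_deriv (leaf_fun d c) (0, v) (s, y) = dir_deriv (\<lambda>y'. transition c e y' \<bullet> ?ax) v y"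
      using dir_deriv_eqI[OF dir_deriv_slice[OF leaf_fun_differentiable[OF c d y]], of v] by simp
    also have "\<dots> = transition_deriv c e y v \<bullet> ?ax"
      by (rule dir_deriv_eqI[OF has_derivative_inner_left[OF transition_derivative[OF c e over]]])
    finally show ?thesis .
  qed
  then have "\<alpha> c y [v] = \<alpha> e z [?ax] * dir_deriv (leaf_fun d c) (0, v) (s, y)" for v
    using form_transition[OF form c e over, of "[v]"] split[of "transition_deriv c e y v"]
    by (simp add: trans)
  then show "\<exists>g. \<forall>v. \<alpha> c y [v] = g * dir_deriv (leaf_fun d c) (0, v) (s, y)" by blast
  have inv: "chart_inv e z = chart_inv c y"
    unfolding z_def by (rule chart_inv_chart_map[OF is_chart[OF e] q(1)])
  have over': "z \<in> overlap e c"
    using z inv q(2) by (simp add: overlap_altdef[OF is_chart[OF e]])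
  have "transition e c z = y"
    using inv chart_map_chart_inv[OF ran] by (simp add: transition_def)
  then have "\<alpha> c y [transition_deriv e c z ?ax] \<noteq> 0"
    using form_transition[OF form e c over', of "[?ax]"] nz by simp
  then show "\<exists>v. \<alpha> c y [v] \<noteq> 0" by blast
qed

lemma leaf_dom_exists:
  assumes "s \<in> I" "x \<in> chart_ran c"
  obtains d where "d \<in> F" "(s, x) \<in> leaf_dom d c"
proof -
  obtain d where "d \<in> F" "\<Phi> s (chart_inv c x) \<in> chart_dom d" using foliated_chart_at by blast
  then show ?thesis using that assms by (simp add: leaf_dom_def)
qed

text \<open>
  If \<open>X\<close> denotes the vector field along which the family moves the leaves, then \<open>\<phi>\<close> is \<open>\<alpha>(X)\<close>: if \<open>\<alpha> = g df\<close> for a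
  leaf function \<open>f\<close>, then \<open>\<phi>\<close> is \<open>g\<close> times the time derivative of \<open>f\<close>. The property \<open>P\<close> in the proof, which
  expresses this without mention of \<open>g\<close>, determines the value at a point and does not distinguish any foliated
  chart.
\<close>

lemma transverse_velocity:
  assumes t: "t \<in> I" and \<alpha>: "defining_form A (pullback_foliation (\<Phi> t) F) \<alpha>"
  shows "\<exists>\<phi>. diff_form A 0 \<phi> \<and> (\<forall>c\<in>A. \<forall>x\<in>chart_ran c. \<forall>d\<in>F. (t, x) \<in> leaf_dom d c \<longrightarrow>
    (\<forall>v. \<phi> c x [] * dir_deriv (leaf_fun d c) (0, v) (t, x) =
      \<alpha> c x [v] * dir_deriv (leaf_fun d c) (1, 0) (t, x)))"
proof -
  have form: "diff_form A 1 \<alpha>" using \<alpha> by (simp add: defining_form_def)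
  define P where "P c x r \<longleftrightarrow> (\<forall>d\<in>F. (t, x) \<in> leaf_dom d c \<longrightarrow>
    (\<forall>v. r * dir_deriv (leaf_fun d c) (0, v) (t, x) = \<alpha> c x [v] * dir_deriv (leaf_fun d c) (1, 0) (t, x)))"
    for c x r
  have transversal: "\<exists>v. dir_deriv (leaf_fun d c) (0, v) (t, x) \<noteq> 0"
    if "c \<in> A" "d \<in> F" "(t, x) \<in> leaf_dom d c" for c d x
    using defining_form_leaf_fun[OF t \<alpha> that] by auto
  have ex: "\<exists>r. P c x r" if c: "c \<in> A" and x: "x \<in> chart_ran c" for c x
  proof -
    obtain d where d: "d \<in> F" "(t, x) \<in> leaf_dom d c" using leaf_dom_exists[OF t x] .
    obtain g where g: "\<And>v. \<alpha> c x [v] = g * dir_deriv (leaf_fun d c) (0, v) (t, x)"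
      using defining_form_leaf_fun(1)[OF t \<alpha> c d] by blast
    have "P c x (g * dir_deriv (leaf_fun d c) (1, 0) (t, x))"
      unfolding P_def
    proof (intro ballI impI allI)
      fix d' v assume d': "d' \<in> F" "(t, x) \<in> leaf_dom d' c"
      obtain k where "\<And>w. dir_deriv (leaf_fun d' c) w (t, x) = k * dir_deriv (leaf_fun d c) w (t, x)"
        using leaf_fun_change_foliated_chart[OF c d(1) d'(1) d(2) d'(2)] by blast
      then show "g * dir_deriv (leaf_fun d c) (1, 0) (t, x) * dir_deriv (leaf_fun d' c) (0, v) (t, x)
          = \<alpha> c x [v] * dir_deriv (leaf_fun d' c) (1, 0) (t, x)"
        by (simp add: g)
    qed
    then show ?thesis by blast
  qed
  have unique: "r = r'" if c: "c \<in> A" and x: "x \<in> chart_ran c" and r: "P c x r" "P c x r'" for c x r r'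
  proof -
    obtain d where d: "d \<in> F" "(t, x) \<in> leaf_dom d c" using leaf_dom_exists[OF t x] .
    obtain v where "dir_deriv (leaf_fun d c) (0, v) (t, x) \<noteq> 0" using transversal[OF c d] by blast
    moreover have "r * dir_deriv (leaf_fun d c) (0, v) (t, x) = r' * dir_deriv (leaf_fun d c) (0, v) (t, x)"
      using r d unfolding P_def by simp
    ultimately show ?thesis by simp
  qed
  obtain h where h: "\<And>c x. c \<in> A \<Longrightarrow> x \<in> chart_ran c \<Longrightarrow> P c x (h c x)"
    using ex by metis
  define \<phi> where "\<phi> = (\<lambda>c x (vs :: 'e list). if c \<in> A \<and> x \<in> chart_ran c \<and> vs = [] then h c x else 0)"
  have "diff_form A 0 \<phi>"
    unfolding \<phi>_def
  proof (rule diff_form_0I)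
    fix c assume c: "c \<in> A"
    have R: "open (chart_ran c)" by (rule chart_ran_open[OF is_chart[OF c]])
    show "smooth_on (chart_ran c) (h c)"
    proof (rule smooth_on_locally)
      fix x assume x: "x \<in> chart_ran c"
      obtain d where d: "d \<in> F" "(t, x) \<in> leaf_dom d c" using leaf_dom_exists[OF t x] .
      obtain v where v: "dir_deriv (leaf_fun d c) (0, v) (t, x) \<noteq> 0" using transversal[OF c d] by blast
      define S where "S = {y. (t, y) \<in> leaf_dom d c}"
      have "open ((\<lambda>y. (t, y)) -` leaf_dom d c)"
        by (rule open_vimage[OF open_leaf_dom[OF c d(1)]]) (intro continuous_intros)
      then have S: "open S" by (simp add: S_def vimage_def)
      have slice: "smooth_on S (\<lambda>y. dir_deriv (leaf_fun d c) w (t, y))" for w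
        by (rule smooth_on_slice[OF open_leaf_dom[OF c d(1)] smooth_on_dir_deriv[OF smooth_leaf_fun[OF c d(1)]] _ S])
          (simp add: S_def)
      define U where "U = {y \<in> S. dir_deriv (leaf_fun d c) (0, v) (t, y) \<noteq> 0}"
      have "open (S \<inter> (\<lambda>y. dir_deriv (leaf_fun d c) (0, v) (t, y)) -` (- {0}))"
        by (rule continuous_open_preimage[OF smooth_on_continuous_on[OF slice] S]) auto
      moreover have "S \<inter> (\<lambda>y. dir_deriv (leaf_fun d c) (0, v) (t, y)) -` (- {0}) = U"
        by (auto simp: U_def)
      ultimately have U: "open U" by simp
      have sub: "U \<subseteq> S" "U \<subseteq> chart_ran c" by (auto simp: U_def S_def leaf_dom_def)
      have "smooth_on U (\<lambda>y. \<alpha> c y [v] * dir_deriv (leaf_fun d c) (1, 0) (t, y)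
          / dir_deriv (leaf_fun d c) (0, v) (t, y))"
        by (intro smooth_on_divide[OF U] smooth_on_mult[OF U] smooth_on_subset[OF slice sub(1)]
            smooth_on_subset[OF form_smooth[OF form c] sub(2)]) (simp add: U_def)
      then have "smooth_on U (h c)"
      proof (rule smooth_on_cong[OF U, rotated])
        fix y assume y: "y \<in> U"
        then have "(t, y) \<in> leaf_dom d c" "y \<in> chart_ran c" using sub by (auto simp: S_def)
        then have "h c y * dir_deriv (leaf_fun d c) (0, v) (t, y)
            = \<alpha> c y [v] * dir_deriv (leaf_fun d c) (1, 0) (t, y)"
          using h[OF c] d(1) unfolding P_def by blast
        then show "\<alpha> c y [v] * dir_deriv (leaf_fun d c) (1, 0) (t, y)
            / dir_deriv (leaf_fun d c) (0, v) (t, y) = h c y"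
          using y by (simp add: U_def field_simps)
      qed
      moreover have "x \<in> U" using d v by (simp add: U_def S_def)
      ultimately show "\<exists>U. open U \<and> x \<in> U \<and> smooth_on U (h c)" using U by blast
    qed
  next
    fix c c' x assume c: "c \<in> A" "c' \<in> A" "x \<in> overlap c c'"
    let ?x' = "transition c c' x"
    have x': "?x' \<in> chart_ran c'" by (rule transition_in_ran[OF c(1,3)])
    have "P c x (h c' ?x')"
      unfolding P_def
    proof (intro ballI impI allI)
      fix d v assume d: "d \<in> F" "(t, x) \<in> leaf_dom d c"
      let ?v' = "transition_deriv c c' x v"
      have "(t, ?x') \<in> leaf_dom d c'" using d leaf_dom_transition(1)[OF c] by simp
      then have "h c' ?x' * dir_deriv (leaf_fun d c') (0, ?v') (t, ?x')
          = \<alpha> c' ?x' [?v'] * dir_deriv (leaf_fun d c') (1, 0) (t, ?x')"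
        using h[OF c(2) x'] d(1) unfolding P_def by blast
      moreover have "transition_deriv c c' x 0 = 0"
        by (rule linear_0[OF linear_transition_deriv[OF c]])
      ultimately show "h c' ?x' * dir_deriv (leaf_fun d c) (0, v) (t, x)
          = \<alpha> c x [v] * dir_deriv (leaf_fun d c) (1, 0) (t, x)"
        using form_transition[OF form c, of "[v]"] by (simp add: leaf_fun_change_chart[OF c d])
    qed
    then show "h c x = h c' ?x'"
      using unique[OF c(1) overlap_in_ran[OF c(3)]] h[OF c(1) overlap_in_ran[OF c(3)]] by blast
  qed
  moreover have "\<phi> c x [] = h c x" if "c \<in> A" "x \<in> chart_ran c" for c x
    using that by (simp add: \<phi>_def)
  ultimately show ?thesis
    using h unfolding P_def by (intro exI[of _ \<phi>]) simp
qed

text \<open>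
  Near the point, \<open>\<alpha> = G df\<close> and \<open>\<phi> = G f'\<close> for the time derivative \<open>f'\<close> of \<open>f\<close>. Hence \<open>\<alpha>' = G' df + G df'\<close> and
  \<open>d\<phi> = f' dG + G df'\<close>, so that \<open>\<alpha>' - d\<phi>\<close> is \<open>- f' dG\<close> up to a multiple of \<open>df\<close>. Since \<open>dG \<and> df = G df \<and> \<beta>\<close>, \<open>dG\<close> is
  \<open>- G \<beta>\<close> up to a multiple of \<open>df\<close>, and the difference becomes \<open>\<phi> \<beta>\<close>.
\<close>

lemma variation_of_defining_form:
  assumes t: "t \<in> I" and adapted: "adapted_forms A I (\<lambda>t. pullback_foliation (\<Phi> t) F) \<alpha> \<beta>"
    and \<phi>: "diff_form A 0 \<phi>"
    and velocity: "\<And>c x d v. c \<in> A \<Longrightarrow> x \<in> chart_ran c \<Longrightarrow> d \<in> F \<Longrightarrow> (t, x) \<in> leaf_dom d c \<Longrightarrow>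
      \<phi> c x [] * dir_deriv (leaf_fun d c) (0, v) (t, x) =
      \<alpha> t c x [v] * dir_deriv (leaf_fun d c) (1, 0) (t, x)"
    and c: "c \<in> A" and x: "x \<in> chart_ran c"
  shows "\<exists>m. \<forall>v. dot \<alpha> t c x [v] =
    \<phi> c x [] * \<beta> t c x [v] + ext_d 0 \<phi> c x [v] - m * \<alpha> t c x [v]"
proof -
  have \<alpha>: "smooth_form_family A I 1 \<alpha>"
    and def: "\<And>s. s \<in> I \<Longrightarrow> defining_form A (pullback_foliation (\<Phi> s) F) (\<alpha> s)"
    and d\<alpha>: "\<And>s. s \<in> I \<Longrightarrow> ext_d 1 (\<alpha> s) = wedge 1 1 (\<alpha> s) (\<beta> s)"
    using adapted unfolding adapted_forms_def by blast+
  have R: "open (chart_ran c)" by (rule chart_ran_open[OF is_chart[OF c]])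
  obtain d where d: "d \<in> F" "(t, x) \<in> leaf_dom d c" using leaf_dom_exists[OF t x] .
  let ?f = "leaf_fun d c"
  have L: "open (leaf_dom d c)" by (rule open_leaf_dom[OF c d(1)])
  have f: "smooth_on (leaf_dom d c) ?f" by (rule smooth_leaf_fun[OF c d(1)])
  obtain z where z: "dir_deriv ?f (0, z) (t, x) \<noteq> 0"
    using defining_form_leaf_fun[OF t def[OF t] c d] by auto
  define U where "U = {p \<in> leaf_dom d c. dir_deriv ?f (0, z) p \<noteq> 0}"
  have "open (leaf_dom d c \<inter> (\<lambda>p. dir_deriv ?f (0, z) p) -` (- {0}))"
    by (rule continuous_open_preimage[OF smooth_on_continuous_on[OF smooth_on_dir_deriv[OF f]] L]) auto
  moreover have "leaf_dom d c \<inter> (\<lambda>p. dir_deriv ?f (0, z) p) -` (- {0}) = U"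
    by (auto simp: U_def)
  ultimately have U: "open U" by simp
  have sub: "U \<subseteq> leaf_dom d c" "U \<subseteq> I \<times> chart_ran c" by (auto simp: U_def leaf_dom_def)
  have tx: "(t, x) \<in> U" using d z by (simp add: U_def)
  \<comment> \<open>The quotient shows that the coefficient depends smoothly on time and space together.\<close>
  define G where "G = (\<lambda>p. \<alpha> (fst p) c (snd p) [z] / dir_deriv ?f (0, z) p)"
  have "smooth_on U G"
    unfolding G_def
    by (intro smooth_on_divide[OF U] smooth_on_subset[OF smooth_on_dir_deriv[OF f] sub(1)]
        smooth_on_subset[OF family_smooth[OF open_I \<alpha> c] sub(2)]) (simp add: U_def)
  then have G: "G differentiable (at (t, x))" by (rule smooth_on_differentiable[OF _ tx])
  have \<alpha>G: "\<alpha> (fst p) c (snd p) [v] = G p * dir_deriv ?f (0, v) p" if p: "p \<in> U" for p v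
  proof -
    have "fst p \<in> I" "(fst p, snd p) \<in> leaf_dom d c" using p sub by auto
    then obtain g where "\<And>v. \<alpha> (fst p) c (snd p) [v] = g * dir_deriv ?f (0, v) p"
      using defining_form_leaf_fun(1)[OF _ def c d(1), of "fst p" "snd p"] by auto
    then show ?thesis using p by (simp add: G_def U_def)
  qed
  define S where "S = {y. (t, y) \<in> U}"
  have "open ((\<lambda>y. (t, y)) -` U)" by (rule open_vimage[OF U]) (intro continuous_intros)
  then have S: "open S" by (simp add: S_def vimage_def)
  have xS: "x \<in> S" using tx by (simp add: S_def)
  have fd: "(\<lambda>p. dir_deriv ?f w p) differentiable (at (t, x))" for w
    by (rule smooth_on_differentiable[OF smooth_on_dir_deriv[OF f] d(2)])
  define g where "g = G (t, x)"
  define Dg where "Dg w = dir_deriv G w (t, x)" for w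
  define Df where "Df w = dir_deriv ?f w (t, x)" for w
  define D2 where "D2 w w' = dir_deriv (\<lambda>p. dir_deriv ?f w p) w' (t, x)" for w w'
  have sym: "D2 w w' = D2 w' w" for w w'
    unfolding D2_def by (rule symmetric_second_derivative[OF L d(2) f])
  define b where "b v = \<beta> t c x [v]" for v
  have a: "\<alpha> t c x [v] = g * Df (0, v)" for v
    using \<alpha>G[OF tx] by (simp add: g_def Df_def)
  have \<alpha>_deriv: "dir_deriv (\<lambda>p. \<alpha> (fst p) c (snd p) [v]) w (t, x) = g * D2 (0, v) w + Dg w * Df (0, v)" for v w
  proof -
    have "dir_deriv (\<lambda>p. \<alpha> (fst p) c (snd p) [v]) w (t, x) = dir_deriv (\<lambda>p. G p * dir_deriv ?f (0, v) p) w (t, x)"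
      by (rule dir_deriv_cong[OF U tx \<alpha>G])
    also have "\<dots> = g * D2 (0, v) w + Dg w * Df (0, v)"
      unfolding g_def D2_def Dg_def Df_def
      by (rule dir_deriv_eqI, intro has_derivative_mult dir_deriv_works G fd)
    finally show ?thesis .
  qed
  have dot: "dot \<alpha> t c x [v] = g * D2 (0, v) (1, 0) + Dg (1, 0) * Df (0, v)" for v
    unfolding dot_has_derivative(2)[OF open_I \<alpha> t c x] by (rule \<alpha>_deriv)
  have space: "dir_deriv (\<lambda>y. \<alpha> t c y [v]) w x = g * D2 (0, v) (0, w) + Dg (0, w) * Df (0, v)" for v w
  proof -
    have "(\<lambda>p. \<alpha> (fst p) c (snd p) [v]) differentiable (at (t, x))"
      by (rule smooth_on_differentiable[OF family_smooth[OF open_I \<alpha> c]]) (use t x in simp)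
    from dir_deriv_eqI[OF dir_deriv_slice[OF this], of w] show ?thesis by (simp add: \<alpha>_deriv)
  qed
  have \<phi>G: "\<phi> c y [] = G (t, y) * dir_deriv ?f (1, 0) (t, y)" if "y \<in> S" for y
  proof -
    have y: "(t, y) \<in> leaf_dom d c" "y \<in> chart_ran c" "dir_deriv ?f (0, z) (t, y) \<noteq> 0"
      using that sub by (auto simp: S_def U_def)
    have "\<phi> c y [] * dir_deriv ?f (0, z) (t, y) = \<alpha> t c y [z] * dir_deriv ?f (1, 0) (t, y)"
      by (rule velocity[OF c y(2) d(1) y(1)])
    then show ?thesis using y(3) by (simp add: G_def field_simps)
  qed
  have \<phi>x: "\<phi> c x [] = g * Df (1, 0)" using \<phi>G[OF xS] by (simp add: g_def Df_def)
  have d\<phi>: "ext_d 0 \<phi> c x [v] = g * D2 (1, 0) (0, v) + Dg (0, v) * Df (1, 0)" for v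
  proof -
    have "ext_d 0 \<phi> c x [v] = dir_deriv (\<lambda>y. G (t, y) * dir_deriv ?f (1, 0) (t, y)) v x"
      unfolding ext_d_0[OF x] by (rule dir_deriv_cong[OF S xS \<phi>G])
    also have "\<dots> = g * D2 (1, 0) (0, v) + Dg (0, v) * Df (1, 0)"
      unfolding g_def D2_def Dg_def Df_def
      by (rule dir_deriv_eqI, intro has_derivative_mult dir_deriv_slice G fd)
    finally show ?thesis .
  qed
  have int: "Dg (0, z) * Df (0, v) - Dg (0, v) * Df (0, z) = g * (Df (0, z) * b v - Df (0, v) * b z)" for v
  proof -
    have "ext_d 1 (\<alpha> t) c x [z, v] = \<alpha> t c x [z] * b v - \<alpha> t c x [v] * b z"
      unfolding d\<alpha>[OF t] wedge_1_1 b_def ..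
    then show ?thesis
      unfolding ext_d_1[OF x] space a using sym[of "(0, z)" "(0, v)"] by (simp add: algebra_simps)
  qed
  have z': "Df (0, z) \<noteq> 0" using z by (simp add: Df_def)
  have g0: "g \<noteq> 0"
    using defining_form_leaf_fun(2)[OF t def[OF t] c d] by (auto simp: a)
  define h where "h = (Dg (0, z) + g * b z) / Df (0, z)"
  define k where "k = Dg (1, 0) - Df (1, 0) * h"
  have Dgv: "Dg (0, v) = h * Df (0, v) - g * b v" for v
    using int[of v] z' by (simp add: h_def field_simps)
  have "dot \<alpha> t c x [v] = \<phi> c x [] * b v + ext_d 0 \<phi> c x [v] + k * Df (0, v)" for v
    unfolding dot \<phi>x d\<phi> k_def Dgv[of v] using sym[of "(0, v)" "(1, 0)"] by (simp add: algebra_simps)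
  then have "\<forall>v. dot \<alpha> t c x [v] = \<phi> c x [] * \<beta> t c x [v] + ext_d 0 \<phi> c x [v] - (- k / g) * \<alpha> t c x [v]"
    using g0 by (simp add: a b_def)
  then show ?thesis by blast
qed

end

theorem theorem10:
  fixes A :: "('m::{t2_space, second_countable_topology}, 'e::euclidean_space) chart set"
    and F :: "('m, 'e) chart set"
    and I :: "real set"
    and \<Phi> :: "real \<Rightarrow> 'm \<Rightarrow> 'm"
    and \<alpha> \<beta> :: "real \<Rightarrow> ('m, 'e) form"
  assumes "smooth_structure A"
    and "oriented_foliation A F"
    and "open I" and "is_interval I"
    and "smooth_diffeo_family A I \<Phi>"
    and "adapted_forms A I (\<lambda>t. pullback_foliation (\<Phi> t) F) \<alpha> \<beta>"
  shows "\<forall>t\<in>I. TGV A \<beta> t \<in> de_Rham A 4 \<and> TGV A \<beta> t = de_Rham_zero A 4"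
proof
  fix t assume t: "t \<in> I"
  interpret pullback_family A F I \<Phi>
    by unfold_locales (fact assms)+
  have \<alpha>: "smooth_form_family A I 1 \<alpha>" and \<beta>: "smooth_form_family A I 1 \<beta>"
    and def: "\<And>s. s \<in> I \<Longrightarrow> defining_form A (pullback_foliation (\<Phi> s) F) (\<alpha> s)"
    and d\<alpha>: "\<And>s. s \<in> I \<Longrightarrow> ext_d 1 (\<alpha> s) = wedge 1 1 (\<alpha> s) (\<beta> s)"
    using assms(6) unfolding adapted_forms_def by blast+
  obtain \<phi> where \<phi>: "diff_form A 0 \<phi>"
    and velocity: "\<forall>c\<in>A. \<forall>x\<in>chart_ran c. \<forall>d\<in>F. (t, x) \<in> leaf_dom d c \<longrightarrow>
      (\<forall>v. \<phi> c x [] * dir_deriv (leaf_fun d c) (0, v) (t, x) =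
        \<alpha> t c x [v] * dir_deriv (leaf_fun d c) (1, 0) (t, x))"
    using transverse_velocity[OF t def[OF t]] by blast
  show "TGV A \<beta> t \<in> de_Rham A 4 \<and> TGV A \<beta> t = de_Rham_zero A 4"
  proof (rule TGV_zero_if_variation[OF \<open>open I\<close> t \<alpha> \<beta> d\<alpha> _ \<phi>])
    fix c x assume c: "c \<in> A" and x: "x \<in> chart_ran c"
    obtain d where "d \<in> F" "(t, x) \<in> leaf_dom d c" using leaf_dom_exists[OF t x] .
    then show "\<exists>v. \<alpha> t c x [v] \<noteq> 0"
      by (rule defining_form_leaf_fun(2)[OF t def[OF t] c])
    show "\<exists>m. \<forall>v. dot \<alpha> t c x [v] = \<phi> c x [] * \<beta> t c x [v] + ext_d 0 \<phi> c x [v] - m * \<alpha> t c x [v]"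
      by (rule variation_of_defining_form[OF t assms(6) \<phi> _ c x]) (use velocity in blast)
  qed
qed

end
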